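(* For every $k\in\mathbb Z$, the function $v_k$ extends to a function of class $C^\infty$ on $P_*:=([0,+\infty)\times\mathbb R)\setminus\{(0,0)\}$ (all its derivatives extend continuously up to the boundary $\{x=0\}$ away from the origin).
   Context: Let $M(a,b,\zeta)=\sum_{n\ge0}\frac{(a)_n}{(b)_n}\frac{\zeta^n}{n!}$ be Kummer's function. For $k\in\mathbb Z$ define $$\Lambda_k(t)=9^{\frac16+k}(1+t^2)^{-\frac14-\frac{3k}2}\Big[\tfrac{\Gamma(1/3)}{\Gamma(1/6-k)}M\big(-\tfrac16-k,\tfrac23,-\tfrac{t^3}{9}\big)-\tfrac{t}{9^{1/3}}\tfrac{\Gamma(-1/3)}{\Gamma(-1/6-k)}M\big(\tfrac16-k,\tfrac43,-\tfrac{t^3}{9}\big)\Big],$$ and for $x>0$, $z\in\mathbb R$, $v_k(x,z):=r^{\frac12+3k}\Lambda_k(t)$ with $r=(z^2+x^{2/3})^{1/2}$, $t=zx^{-1/3}$. *)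

theory Defs
  imports "HOL-Analysis.Analysis"
begin

definition kummerM :: "real \<Rightarrow> real \<Rightarrow> real \<Rightarrow> real" where
  "kummerM a b \<zeta> = (\<Sum>n. pochhammer a n / pochhammer b n * \<zeta> ^ n / fact n)"

definition Lambda :: "int \<Rightarrow> real \<Rightarrow> real" where
  "Lambda k t = 9 powr (1/6 + real_of_int k) * (1 + t\<^sup>2) powr (-1/4 - 3 * real_of_int k / 2) *
     (Gamma (1/3) / Gamma (1/6 - real_of_int k) * kummerM (-1/6 - real_of_int k) (2/3) (- (t ^ 3) / 9)
      - t / 9 powr (1/3) * (Gamma (-1/3) / Gamma (-1/6 - real_of_int k))
          * kummerM (1/6 - real_of_int k) (4/3) (- (t ^ 3) / 9))"

text \<open>v_k(x,z) = r^(1/2+3k) Lambda_k(t), r = sqrt(z^2 + x^(2/3)), t = z x^(-1/3); meaningful for x > 0.\<close>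
definition v :: "int \<Rightarrow> real \<times> real \<Rightarrow> real" where
  "v k p = (let x = fst p; z = snd p;
               r = sqrt (z\<^sup>2 + x powr (2/3)); t = z * x powr (-1/3)
            in r powr (1/2 + 3 * real_of_int k) * Lambda k t)"

definition Hplus :: "(real \<times> real) set" where
  "Hplus = {p. fst p > 0}"

definition Pstar :: "(real \<times> real) set" where
  "Pstar = {p. fst p \<ge> 0} - {(0, 0)}"

definition partial :: "bool \<Rightarrow> (real \<times> real \<Rightarrow> real) \<Rightarrow> real \<times> real \<Rightarrow> real" where
  "partial b f p = (if b then deriv (\<lambda>s. f (s, snd p)) (fst p)
                    else deriv (\<lambda>s. f (fst p, s)) (snd p))"

definition pdw :: "bool list \<Rightarrow> (real \<times> real \<Rightarrow> real) \<Rightarrow> real \<times> real \<Rightarrow> real" where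
  "pdw ws f = foldr partial ws f"

definition smooth_ext_Pstar :: "(real \<times> real \<Rightarrow> real) \<Rightarrow> bool" where
  "smooth_ext_Pstar f \<longleftrightarrow>
     (\<forall>ws. (\<forall>p\<in>Hplus. (\<lambda>s. pdw ws f (s, snd p)) differentiable (at (fst p))
                      \<and> (\<lambda>s. pdw ws f (fst p, s)) differentiable (at (snd p)))
         \<and> (\<exists>g. continuous_on Pstar g \<and> (\<forall>p\<in>Hplus. g p = pdw ws f p)))"

end

theory Submission
  imports Defs "HOL-Real_Asymp.Real_Asymp"
begin

text \<open>
  For \<open>x > 0\<close> one has \<open>v\<^sub>k(x,z) = (9x)\<^sup>\<kappa> U(-\<kappa>, t)\<close> with \<open>\<kappa> = 1/6 + k\<close>, \<open>t = z x\<^sup>-\<^sup>1\<^sup>/\<^sup>3\<close> and \<open>U(a, t)\<close> Tricomi's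
  function of \<open>- t\<^sup>3/9\<close>. These functions solve the Kolmogorov equation \<open>\<partial>\<^sub>z\<^sup>2 v = z \<partial>\<^sub>x v\<close>, and \<open>\<partial>\<^sub>x v\<^sub>k\<close> is a
  multiple of \<open>v\<^sub>k\<^sub>-\<^sub>1\<close>. Hence every partial derivative of \<open>v\<^sub>k\<close> is a combination of the \<open>v\<^sub>j\<close> and \<open>\<partial>\<^sub>z v\<^sub>j\<close> with
  coefficients polynomial in \<open>z\<close>, and only continuity of these up to the boundary is needed. By
  self-similarity this means that \<open>\<bar>t\<bar>\<^sup>3\<^sup>a U(a, t)\<close> converges as \<open>t \<rightarrow> \<plusminus>\<infinity>\<close>. The derivative of this product is a
  multiple of \<open>\<bar>t\<bar>\<^sup>3\<^sup>a\<^sup>-\<^sup>1 U(a + 1, t)\<close>, so it suffices that \<open>\<bar>t\<bar>\<^sup>3\<^sup>a U(a, t)\<close> is bounded for all \<open>a\<close>. For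
  \<open>t \<rightarrow> \<infinity>\<close> this is an energy estimate; for \<open>t \<rightarrow> -\<infinity>\<close>, where generic solutions grow exponentially, it
  follows for \<open>a > 0\<close> from the Laplace integral of \<open>U\<close>, and then for all \<open>a\<close> by descent \<open>a + 1 \<mapsto> a\<close>.
\<close>

subsection \<open>Kummer series and the recurrences of Tricomi's function\<close>

lemma kummer_summable:
  fixes a b x :: real
  assumes b: "b > 0"
  shows "summable (\<lambda>n. pochhammer a n / pochhammer b n / fact n * x ^ n)"
proof -
  \<comment> \<open>The quotients (a + n)/(b + n) are bounded by \<open>K\<close> uniformly in n, so
    the factor 1/(n + 1) alone brings the term ratio below 1/2 once n >= 2 K |x|.\<close>
  define K where "K = 1 + \<bar>a\<bar> / b"
  have K: "\<bar>a + real n\<bar> \<le> K * (b + real n)" for n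
  proof -
    have "\<bar>a + real n\<bar> \<le> \<bar>a\<bar> + (b + real n)" using b by linarith
    moreover have "\<bar>a\<bar> * 1 \<le> \<bar>a\<bar> * ((b + real n) / b)"
      using b by (intro mult_left_mono) auto
    ultimately show ?thesis by (simp add: K_def algebra_simps)
  qed
  have half: "\<bar>q * x / (m + 1)\<bar> \<le> 1/2" if "\<bar>q\<bar> * \<bar>x\<bar> \<le> 1/2 * (m + 1)" "m \<ge> 0" for q m :: real
    using that by (simp add: abs_mult divide_le_eq)
  obtain N :: nat where N: "2 * (K * \<bar>x\<bar>) \<le> real N"
    using real_arch_simple by blast
  show ?thesis
  proof (rule summable_ratio_test[of "1/2" N])
    fix n assume "n \<ge> N"
    define c where "c n = pochhammer a n / pochhammer b n / fact n * x ^ n" for n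
    have eq: "c (Suc n) = ((a + real n) / (b + real n) * x / (real n + 1)) * c n"
      by (simp add: c_def pochhammer_rec' field_simps)
    have "\<bar>(a + real n) / (b + real n)\<bar> \<le> K"
      using K[of n] b by (simp add: abs_divide divide_le_eq)
    then have "\<bar>(a + real n) / (b + real n)\<bar> * \<bar>x\<bar> \<le> K * \<bar>x\<bar>"
      by (intro mult_right_mono) auto
    also have "K * \<bar>x\<bar> \<le> 1/2 * (real n + 1)"
      using N \<open>n \<ge> N\<close> by simp
    finally have "\<bar>(a + real n) / (b + real n) * x / (real n + 1)\<bar> \<le> 1/2"
      by (rule half) simp
    then have "\<bar>c (Suc n)\<bar> \<le> 1/2 * \<bar>c n\<bar>"
      unfolding eq abs_mult[of _ "c n"] by (intro mult_right_mono) auto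
    then show "norm (pochhammer a (Suc n) / pochhammer b (Suc n) / fact (Suc n) * x ^ Suc n)
        \<le> 1/2 * norm (pochhammer a n / pochhammer b n / fact n * x ^ n)"
      by (simp add: c_def)
  qed simp
qed

lemma kummerM_sums:
  assumes "b > 0"
  shows "(\<lambda>n. pochhammer a n / pochhammer b n / fact n * x ^ n) sums kummerM a b x"
  using summable_sums[OF kummer_summable[OF assms, of a x]] by (simp add: kummerM_def)

lemma has_real_derivative_kummerM:
  assumes b: "b > 0"
  shows "(kummerM a b has_real_derivative a / b * kummerM (a + 1) (b + 1) x) (at x)"
proof -
  define c where "c n = pochhammer a n / pochhammer b n / fact n" for n
  have "(\<lambda>n. a / b * (pochhammer (a + 1) n / pochhammer (b + 1) n / fact n * x ^ n))
      sums (a / b * kummerM (a + 1) (b + 1) x)"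
    using b by (intro sums_mult kummerM_sums) auto
  moreover have "(\<lambda>n. a / b * (pochhammer (a + 1) n / pochhammer (b + 1) n / fact n * x ^ n))
      = (\<lambda>n. diffs c n * x ^ n)"
    by (simp add: fun_eq_iff diffs_def c_def pochhammer_rec field_simps del: of_nat_Suc)
  ultimately have "(\<Sum>n. diffs c n * x ^ n) = a / b * kummerM (a + 1) (b + 1) x"
    by (simp add: sums_iff)
  moreover have "kummerM a b = (\<lambda>x. \<Sum>n. c n * x ^ n)"
    by (simp add: kummerM_def c_def fun_eq_iff)
  ultimately show ?thesis
    using termdiffs_strong_converges_everywhere[of c x] kummer_summable[OF b, of a]
    by (simp add: c_def)
qed

text \<open>The operator x d/dx multiplies the n-th term by n, and the fraction a/b times the
  shifted series is M'. With \<open>\<beta>\<close> = a the factor (a + n) raises a; with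
  \<open>\<beta>\<close> = b, applied to the series with parameter b + 1, the factor (b + n) lowers
  b + 1 to b.\<close>

lemma kummerM_euler_operator_sums:
  assumes b: "b > 0"
  shows "(\<lambda>n. (\<beta> + real n) * (pochhammer a n / pochhammer b n / fact n * x ^ n))
    sums (x * (a / b * kummerM (a + 1) (b + 1) x) + \<beta> * kummerM a b x)"
proof -
  let ?c = "\<lambda>n. pochhammer a n / pochhammer b n / fact n * x ^ n"
  have "(\<lambda>n. x * (a / b) * (pochhammer (a + 1) n / pochhammer (b + 1) n / fact n * x ^ n))
      sums (x * (a / b) * kummerM (a + 1) (b + 1) x)"
    using b by (intro sums_mult kummerM_sums) auto
  moreover have "(\<lambda>n. x * (a / b) * (pochhammer (a + 1) n / pochhammer (b + 1) n / fact n * x ^ n))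
      = (\<lambda>n. real (Suc n) * ?c (Suc n))"
    by (simp add: fun_eq_iff pochhammer_rec field_simps del: of_nat_Suc)
  ultimately have "(\<lambda>n. real (Suc n) * ?c (Suc n)) sums (x * (a / b) * kummerM (a + 1) (b + 1) x)"
    by (simp only:)
  then have "(\<lambda>n. real n * ?c n) sums (x * (a / b) * kummerM (a + 1) (b + 1) x)"
    by (rule sums_Suc_imp[rotated]) simp
  from sums_add[OF sums_mult[OF kummerM_sums[OF b], of \<beta>] this]
  show ?thesis by (simp only: distrib_right mult.assoc add.commute)
qed

lemma kummerM_raise_a:
  assumes b: "b > 0"
  shows "x * (a / b * kummerM (a + 1) (b + 1) x) + a * kummerM a b x = a * kummerM (a + 1) b x"
proof -
  have "(a + real n) * (pochhammer a n / pochhammer b n / fact n * x ^ n)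
      = a * (pochhammer (a + 1) n / pochhammer b n / fact n * x ^ n)" for n
  proof -
    have "(a + real n) * pochhammer a n = a * pochhammer (a + 1) n"
      by (metis pochhammer_rec pochhammer_rec')
    then show ?thesis by (simp only: times_divide_eq_right mult.assoc[symmetric] times_divide_eq_left)
  qed
  then have "(\<lambda>n. a * (pochhammer (a + 1) n / pochhammer b n / fact n * x ^ n))
      sums (x * (a / b * kummerM (a + 1) (b + 1) x) + a * kummerM a b x)"
    using kummerM_euler_operator_sums[OF b, of a a x] by (simp only:)
  then show ?thesis
    using sums_mult[OF kummerM_sums[OF b, of "a + 1" x], of a] by (rule sums_unique2)
qed

lemma kummerM_lower_b:
  assumes b: "b > 0"
  shows "x * (a / (b + 1) * kummerM (a + 1) (b + 2) x) + b * kummerM a (b + 1) x = b * kummerM a b x"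
proof -
  have "(b + real n) * (pochhammer a n / pochhammer (b + 1) n / fact n * x ^ n)
      = b * (pochhammer a n / pochhammer b n / fact n * x ^ n)" for n
  proof -
    have "(b + real n) * pochhammer b n = b * pochhammer (b + 1) n"
      by (metis pochhammer_rec pochhammer_rec')
    moreover have "pochhammer b n > 0" "pochhammer (b + 1) n > 0"
      using b by (auto intro!: pochhammer_pos)
    ultimately have "(b + real n) / pochhammer (b + 1) n = b / pochhammer b n"
      by (simp add: divide_simps mult_ac)
    then have "(b + real n) / pochhammer (b + 1) n * (pochhammer a n / fact n * x ^ n)
        = b / pochhammer b n * (pochhammer a n / fact n * x ^ n)" by (rule arg_cong)
    then show ?thesis by (simp add: mult_ac)
  qed
  moreover have "b + 1 + 1 = b + 2" "b + 1 > 0" using b by simp_all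
  ultimately have "(\<lambda>n. b * (pochhammer a n / pochhammer b n / fact n * x ^ n))
      sums (x * (a / (b + 1) * kummerM (a + 1) (b + 2) x) + b * kummerM a (b + 1) x)"
    using kummerM_euler_operator_sums[of "b + 1" b a x] by (simp only:)
  then show ?thesis
    using sums_mult[OF kummerM_sums[OF b, of a x], of b] by (rule sums_unique2)
qed

text \<open>Both sides equal a M(a + 1, b, x): the left one by lowering b in the derivative, the
  right one by raising a.\<close>

lemma kummer_ode:
  assumes b: "b > 0"
  shows "x * (a / b * ((a + 1) / (b + 1) * kummerM (a + 2) (b + 2) x))
    + b * (a / b * kummerM (a + 1) (b + 1) x)
    = x * (a / b * kummerM (a + 1) (b + 1) x) + a * kummerM a b x"
proof -
  have "x * ((a + 1) / (b + 1) * kummerM (a + 2) (b + 2) x) + b * kummerM (a + 1) (b + 1) x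
      = b * kummerM (a + 1) b x"
    using kummerM_lower_b[OF b, of x "a + 1"] by (simp add: add.assoc)
  then have "a / b * (x * ((a + 1) / (b + 1) * kummerM (a + 2) (b + 2) x) + b * kummerM (a + 1) (b + 1) x)
      = a / b * (b * kummerM (a + 1) b x)" by (rule arg_cong)
  also have "\<dots> = a * kummerM (a + 1) b x" using b by simp
  finally show ?thesis unfolding kummerM_raise_a[OF b] by (simp only: algebra_simps)
qed

text \<open>With \<open>\<zeta> = - t\<^sup>3 / 9\<close> this is Tricomi's function \<open>U(a, 2/3, \<zeta>)\<close>, continued to negative \<open>\<zeta>\<close>
  through the real cube root of \<open>\<zeta>\<close>.\<close>

definition tricomi :: "real \<Rightarrow> real \<Rightarrow> real" where
  "tricomi a t = Gamma (1/3) * rGamma (a + 1/3) * kummerM a (2/3) (- (t ^ 3) / 9)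
    - t / 9 powr (1/3) * (Gamma (-1/3) * rGamma a) * kummerM (a + 1/3) (4/3) (- (t ^ 3) / 9)"

text \<open>An explicit formula instead of \<open>deriv\<close>, so that the value at 0 can be read
  off. The entire function \<open>rGamma\<close> keeps it meaningful for every real a, including the
  poles of Gamma.\<close>

definition tricomi' :: "real \<Rightarrow> real \<Rightarrow> real" where
  "tricomi' a t =
     Gamma (1/3) * rGamma (a + 1/3) * (- (t\<^sup>2) / 3 * (a / (2/3) * kummerM (a + 1) (2/3 + 1) (- (t ^ 3) / 9)))
     - 1 / 9 powr (1/3) * (Gamma (-1/3) * rGamma a) *
       (kummerM (a + 1/3) (4/3) (- (t ^ 3) / 9)
        - t ^ 3 / 3 * ((a + 1/3) / (4/3) * kummerM (a + 1/3 + 1) (4/3 + 1) (- (t ^ 3) / 9)))"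

lemma has_real_derivative_kummerM_cubic:
  assumes b: "b > 0"
  shows "((\<lambda>t. kummerM a b (- (t ^ 3) / 9)) has_real_derivative
    - (t\<^sup>2) / 3 * (a / b * kummerM (a + 1) (b + 1) (- (t ^ 3) / 9))) (at t)"
proof -
  have "((\<lambda>t. - (t ^ 3) / 9 :: real) has_real_derivative - (t\<^sup>2) / 3) (at t)"
    by (auto intro!: derivative_eq_intros simp: power2_eq_square)
  from DERIV_chain2[OF has_real_derivative_kummerM[OF b] this] show ?thesis
    by (simp add: mult_ac)
qed

lemma has_real_derivative_tricomi: "(tricomi a has_real_derivative tricomi' a t) (at t)"
proof -
  let ?\<zeta> = "- (t ^ 3) / 9"
  define m1 where "m1 = a / (2/3) * kummerM (a + 1) (2/3 + 1) ?\<zeta>"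
  define n0 where "n0 = kummerM (a + 1/3) (4/3) ?\<zeta>"
  define n1 where "n1 = (a + 1/3) / (4/3) * kummerM (a + 1/3 + 1) (4/3 + 1) ?\<zeta>"
  define A where "A = Gamma (1/3) * rGamma (a + 1/3)"
  define B where "B = 1 / 9 powr (1/3) * (Gamma (-1/3) * rGamma a)"
  have d1: "((\<lambda>t. kummerM a (2/3) (- (t ^ 3) / 9)) has_real_derivative - (t\<^sup>2) / 3 * m1) (at t)"
    unfolding m1_def by (rule has_real_derivative_kummerM_cubic) simp
  have d2: "((\<lambda>t. kummerM (a + 1/3) (4/3) (- (t ^ 3) / 9)) has_real_derivative - (t\<^sup>2) / 3 * n1) (at t)"
    unfolding n1_def by (rule has_real_derivative_kummerM_cubic) simp
  have "((\<lambda>t. A * kummerM a (2/3) (- (t ^ 3) / 9) - B * (t * kummerM (a + 1/3) (4/3) (- (t ^ 3) / 9)))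
      has_real_derivative A * (- (t\<^sup>2) / 3 * m1) - B * (t * (- (t\<^sup>2) / 3 * n1) + 1 * n0)) (at t)"
    unfolding n0_def by (intro DERIV_diff DERIV_cmult DERIV_mult' DERIV_ident d1 d2)
  moreover have "t * (- (t\<^sup>2) / 3 * n1) + 1 * n0 = n0 - t ^ 3 / 3 * n1"
    by (simp add: power2_eq_square power3_eq_cube)
  moreover have "tricomi a = (\<lambda>t. A * kummerM a (2/3) (- (t ^ 3) / 9)
      - B * (t * kummerM (a + 1/3) (4/3) (- (t ^ 3) / 9)))"
    by (simp add: tricomi_def A_def B_def fun_eq_iff)
  moreover have "tricomi' a t = A * (- (t\<^sup>2) / 3 * m1) - B * (n0 - t ^ 3 / 3 * n1)"
    unfolding tricomi'_def A_def B_def m1_def n0_def n1_def ..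
  ultimately show ?thesis by metis
qed

text \<open>In the variable t the singular point of Kummer's equation disappears: both summands of
  \<open>tricomi\<close> solve f'' + (t^2/3) f' + a t f = 0. The polynomial coefficients later allow
  a uniqueness argument starting at t = 0.\<close>

lemma has_real_derivative_tricomi':
  "(tricomi' a has_real_derivative - (t\<^sup>2) / 3 * tricomi' a t - a * t * tricomi a t) (at t)"
proof -
  let ?\<zeta> = "- (t ^ 3) / 9"
  define m0 where "m0 = kummerM a (2/3) ?\<zeta>"
  define M1 where "M1 = (\<lambda>t. a / (2/3) * kummerM (a + 1) (2/3 + 1) (- (t ^ 3) / 9))"
  define m2 where "m2 = a / (2/3) * ((a + 1) / (2/3 + 1) * kummerM (a + 2) (2/3 + 2) ?\<zeta>)"
  define N0 where "N0 = (\<lambda>t. kummerM (a + 1/3) (4/3) (- (t ^ 3) / 9))"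
  define N1 where "N1 = (\<lambda>t. (a + 1/3) / (4/3) * kummerM (a + 1/3 + 1) (4/3 + 1) (- (t ^ 3) / 9))"
  define n2 where "n2 = (a + 1/3) / (4/3) * ((a + 1/3 + 1) / (4/3 + 1) * kummerM (a + 1/3 + 2) (4/3 + 2) ?\<zeta>)"
  define A where "A = Gamma (1/3) * rGamma (a + 1/3)"
  define B where "B = 1 / 9 powr (1/3) * (Gamma (-1/3) * rGamma a)"
  have ode1: "?\<zeta> * m2 + 2/3 * M1 t = ?\<zeta> * M1 t + a * m0"
    unfolding m0_def M1_def m2_def by (rule kummer_ode) simp
  have ode2: "?\<zeta> * n2 + 4/3 * N1 t = ?\<zeta> * N1 t + (a + 1/3) * N0 t"
    unfolding N0_def N1_def n2_def by (rule kummer_ode) simp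
  have two: "x + 1 + 1 = x + 2" for x :: real by simp
  have d1: "(M1 has_real_derivative - (t\<^sup>2) / 3 * m2) (at t)"
    using DERIV_cmult[OF has_real_derivative_kummerM_cubic[of "2/3 + 1" "a + 1" t], of "a / (2/3)"]
    unfolding M1_def m2_def two by (simp only: mult_ac)
  have d0: "(N0 has_real_derivative - (t\<^sup>2) / 3 * N1 t) (at t)"
    unfolding N0_def N1_def by (rule has_real_derivative_kummerM_cubic) simp
  have d2: "(N1 has_real_derivative - (t\<^sup>2) / 3 * n2) (at t)"
    using DERIV_cmult[OF has_real_derivative_kummerM_cubic[of "4/3 + 1" "a + 1/3 + 1" t], of "(a + 1/3) / (4/3)"]
    unfolding N1_def n2_def two by (simp only: mult_ac)
  have q: "((\<lambda>t. - (t\<^sup>2) / 3 :: real) has_real_derivative - (2 * t) / 3) (at t)"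
          "((\<lambda>t. t ^ 3 / 3 :: real) has_real_derivative t\<^sup>2) (at t)"
    by (auto intro!: derivative_eq_intros)
  have "((\<lambda>t. A * (- (t\<^sup>2) / 3 * M1 t) - B * (N0 t - t ^ 3 / 3 * N1 t)) has_real_derivative
      A * (- (t\<^sup>2) / 3 * (- (t\<^sup>2) / 3 * m2) + - (2 * t) / 3 * M1 t)
      - B * (- (t\<^sup>2) / 3 * N1 t - (t ^ 3 / 3 * (- (t\<^sup>2) / 3 * n2) + t\<^sup>2 * N1 t))) (at t)"
    by (intro DERIV_diff DERIV_cmult DERIV_mult' d0 d1 d2 q)
  moreover have "(\<lambda>t. A * (- (t\<^sup>2) / 3 * M1 t) - B * (N0 t - t ^ 3 / 3 * N1 t)) = tricomi' a"
    unfolding tricomi'_def[abs_def] A_def B_def M1_def N0_def N1_def ..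
  \<comment> \<open>The second derivative is regrouped so that the left sides of \<open>ode1\<close>
    and \<open>ode2\<close> appear; Kummer's equation then removes \<open>m2\<close> and
    \<open>n2\<close>.\<close>
  moreover have "A * (- (t\<^sup>2) / 3 * (- (t\<^sup>2) / 3 * m2) + - (2 * t) / 3 * M1 t)
      - B * (- (t\<^sup>2) / 3 * N1 t - (t ^ 3 / 3 * (- (t\<^sup>2) / 3 * n2) + t\<^sup>2 * N1 t))
      = - t * A * (?\<zeta> * m2 + 2/3 * M1 t) + t\<^sup>2 * B * (?\<zeta> * n2 + 4/3 * N1 t)"
    by (simp add: power2_eq_square power3_eq_cube algebra_simps)
  moreover have "\<dots> = - (t\<^sup>2) / 3 * (A * (- (t\<^sup>2) / 3 * M1 t) - B * (N0 t - t ^ 3 / 3 * N1 t))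
      - a * t * (A * m0 - B * (t * N0 t))"
    unfolding ode1 ode2 by (simp add: power2_eq_square power3_eq_cube algebra_simps)
  moreover have "A * (- (t\<^sup>2) / 3 * M1 t) - B * (N0 t - t ^ 3 / 3 * N1 t) = tricomi' a t"
    unfolding tricomi'_def A_def B_def M1_def N0_def N1_def ..
  moreover have "A * m0 - B * (t * N0 t) = tricomi a t"
    by (simp add: tricomi_def A_def B_def m0_def N0_def)
  ultimately show ?thesis by metis
qed

text \<open>Since t d/dt is three times the Euler operator in zeta, \<open>kummerM_raise_a\<close>
  shifts a in both series. The functional equation in the form \<open>rGamma_plus1\<close> shifts
  both coefficients to match, also at the poles of Gamma.\<close>

lemma tricomi_euler_operator:
  "t * tricomi' a t = - 3 * a * tricomi a t + 3 * a * (a + 1/3) * tricomi (a + 1) t"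
proof -
  let ?\<zeta> = "- (t ^ 3) / 9"
  define m0 where "m0 = kummerM a (2/3) ?\<zeta>"
  define m1 where "m1 = a / (2/3) * kummerM (a + 1) (2/3 + 1) ?\<zeta>"
  define m0' where "m0' = kummerM (a + 1) (2/3) ?\<zeta>"
  define n0 where "n0 = kummerM (a + 1/3) (4/3) ?\<zeta>"
  define n1 where "n1 = (a + 1/3) / (4/3) * kummerM (a + 1/3 + 1) (4/3 + 1) ?\<zeta>"
  define n0' where "n0' = kummerM (a + 1/3 + 1) (4/3) ?\<zeta>"
  define A where "A = Gamma (1/3) * rGamma (a + 1/3)"
  define B where "B = 1 / 9 powr (1/3) * (Gamma (-1/3) * rGamma a)"
  define A' where "A' = Gamma (1/3) * rGamma (a + 1 + 1/3)"
  define B' where "B' = 1 / 9 powr (1/3) * (Gamma (-1/3) * rGamma (a + 1))"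
  have e1: "?\<zeta> * m1 + a * m0 = a * m0'"
    unfolding m1_def m0_def m0'_def by (rule kummerM_raise_a) simp
  have e2: "?\<zeta> * n1 + (a + 1/3) * n0 = (a + 1/3) * n0'"
    unfolding n1_def n0_def n0'_def by (rule kummerM_raise_a) simp
  have r1: "(a + 1/3) * A' = A"
    using rGamma_plus1[of "a + 1/3"] by (simp add: A_def A'_def add_ac)
  have r2: "a * B' = B"
    using rGamma_plus1[of a] by (simp add: B_def B'_def mult.left_commute)
  have "a + 1 + 1/3 = a + 1/3 + 1" by simp
  then have T': "tricomi (a + 1) t = A' * m0' - t * B' * n0'"
    unfolding tricomi_def A'_def B'_def m0'_def n0'_def by simp
  have T: "tricomi a t = A * m0 - t * B * n0"
    by (simp add: tricomi_def A_def B_def m0_def n0_def)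
  have D: "tricomi' a t = A * (- (t\<^sup>2) / 3 * m1) - B * (n0 - t ^ 3 / 3 * n1)"
    unfolding tricomi'_def A_def B_def m1_def n0_def n1_def ..
  have "a * (a + 1/3) * tricomi (a + 1) t = ((a + 1/3) * A') * (a * m0') - t * (a * B') * ((a + 1/3) * n0')"
    unfolding T' by (simp only: algebra_simps)
  also have "\<dots> = A * (?\<zeta> * m1 + a * m0) - t * B * (?\<zeta> * n1 + (a + 1/3) * n0)"
    unfolding r1 r2 e1 e2 ..
  finally show ?thesis
    unfolding T D by (simp add: power2_eq_square power3_eq_cube algebra_simps)
qed

subsection \<open>Growth of Tricomi's function\<close>

text \<open>The term C/(3 t^3) is the integral of C/t^4 over [t, \<infinity>). Adding it to P gives
  a nonincreasing function \<open>u\<close>, subtracting it a nondecreasing function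
  \<open>l\<close>; as l <= P <= u, the function \<open>l\<close> converges to its supremum, and P -
  l tends to 0.\<close>

lemma tendsto_at_top_of_derivative_bound:
  fixes P P' :: "real \<Rightarrow> real"
  assumes der: "\<And>t. t \<ge> 1 \<Longrightarrow> (P has_real_derivative P' t) (at t)"
    and bound: "\<And>t. t \<ge> 1 \<Longrightarrow> \<bar>P' t\<bar> \<le> C / t ^ 4"
  shows "\<exists>L. (P \<longlongrightarrow> L) at_top" and "\<exists>B. \<forall>t\<ge>1. \<bar>P t\<bar> \<le> B"
proof -
  define u where "u t = P t + C / (3 * t ^ 3)" for t
  define l where "l t = P t - C / (3 * t ^ 3)" for t
  have "C \<ge> 0" using bound[of 1] by simp
  have dq: "((\<lambda>t. C / (3 * t ^ 3)) has_real_derivative - C / t ^ 4) (at t)" if "t \<ge> 1" for t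
    using that by (auto intro!: derivative_eq_intros simp: field_simps power_eq_if)
  have u_mono: "u t \<le> u s" if "1 \<le> s" "s \<le> t" for s t
  proof (rule DERIV_nonpos_imp_nonincreasing[OF that(2)])
    fix x assume "s \<le> x" "x \<le> t"
    then have x: "x \<ge> 1" using that by simp
    show "\<exists>y. (u has_real_derivative y) (at x) \<and> y \<le> 0"
      unfolding u_def using DERIV_add[OF der[OF x] dq[OF x]] bound[OF x] by (intro exI conjI) auto
  qed
  have l_mono: "l s \<le> l t" if "1 \<le> s" "s \<le> t" for s t
  proof (rule DERIV_nonneg_imp_nondecreasing[OF that(2)])
    fix x assume "s \<le> x" "x \<le> t"
    then have x: "x \<ge> 1" using that by simp
    show "\<exists>y. (l has_real_derivative y) (at x) \<and> y \<ge> 0"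
      unfolding l_def using DERIV_diff[OF der[OF x] dq[OF x]] bound[OF x] by (intro exI conjI) auto
  qed
  have lPu: "l t \<le> P t" "P t \<le> u t" if "t \<ge> 1" for t
    using that \<open>C \<ge> 0\<close> by (auto simp: l_def u_def)
  have bounds: "l 1 \<le> P t" "P t \<le> u 1" if "t \<ge> 1" for t
    using that lPu[OF that] l_mono[of 1 t] u_mono[of 1 t] by auto
  then show "\<exists>B. \<forall>t\<ge>1. \<bar>P t\<bar> \<le> B"
    by (intro exI[of _ "\<bar>l 1\<bar> + \<bar>u 1\<bar>"]) force
  define S where "S = Sup (l ` {1..})"
  have bdd: "bdd_above (l ` {1..})"
    using lPu bounds by (intro bdd_aboveI[of _ "u 1"]) force
  have "(l \<longlongrightarrow> S) at_top"
  proof (rule increasing_tendsto)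
    show "\<forall>\<^sub>F t in at_top. l t \<le> S"
      using eventually_ge_at_top[of 1] unfolding S_def
      by eventually_elim (auto intro!: cSup_upper bdd)
    fix x assume "x < S"
    then obtain s where s: "s \<ge> 1" "x < l s"
      unfolding S_def using less_cSup_iff[OF _ bdd] by auto
    show "\<forall>\<^sub>F t in at_top. x < l t"
      using eventually_ge_at_top[of s] by eventually_elim (use s l_mono in force)
  qed
  moreover have "((\<lambda>t. C / (3 * t ^ 3)) \<longlongrightarrow> 0) at_top"
    by (intro tendsto_divide_0[OF tendsto_const] filterlim_at_top_imp_at_infinity
        filterlim_tendsto_pos_mult_at_top[OF tendsto_const] filterlim_pow_at_top filterlim_ident) auto
  ultimately have "((\<lambda>t. l t + C / (3 * t ^ 3)) \<longlongrightarrow> S + 0) at_top"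
    by (rule tendsto_add)
  then show "\<exists>L. (P \<longlongrightarrow> L) at_top"
    by (auto simp: l_def)
qed

lemma continuous_on_tricomi [continuous_intros]:
  "continuous_on A f \<Longrightarrow> continuous_on A (\<lambda>x. tricomi a (f x))"
  using continuous_on_compose2[of UNIV "tricomi a" A f]
  by (auto intro!: DERIV_continuous_on has_field_derivative_at_within[OF has_real_derivative_tricomi])

text \<open>By the Euler relation the derivative of t^(3a) U(a) contains U(a + 1) only, and the
  hypothesis makes it O(t^-4), because (3a - 1) - 3(a + 1) = -4. The second conclusion has the form
  of the hypothesis with a in place of a + 1, so the descent can be iterated.\<close>

lemma tricomi_asymptotics_descent:
  fixes \<sigma> :: real
  assumes bound: "\<And>t. t \<ge> 1 \<Longrightarrow> \<bar>tricomi (a + 1) (\<sigma> * t)\<bar> \<le> C * t powr (- 3 * (a + 1))"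
  shows "\<exists>L. ((\<lambda>t. t powr (3 * a) * tricomi a (\<sigma> * t)) \<longlongrightarrow> L) at_top" (is ?lim)
    and "\<exists>B. \<forall>t\<ge>1. \<bar>tricomi a (\<sigma> * t)\<bar> \<le> B * t powr (- 3 * a)" (is ?bdd)
proof -
  define P where "P = (\<lambda>t. t powr (3 * a) * tricomi a (\<sigma> * t))"
  define c where "c = 3 * a * (a + 1/3)"
  define P' where "P' = (\<lambda>t. c * t powr (3 * a - 1) * tricomi (a + 1) (\<sigma> * t))"
  have der: "(P has_real_derivative P' t) (at t)" if "t \<ge> 1" for t
  proof -
    have "((\<lambda>t. tricomi a (\<sigma> * t)) has_real_derivative tricomi' a (\<sigma> * t) * \<sigma>) (at t)"
      by (rule DERIV_chain2[OF has_real_derivative_tricomi]) (auto intro!: derivative_eq_intros)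
    then have "(P has_real_derivative
        3 * a * t powr (3 * a - 1) * tricomi a (\<sigma> * t) + tricomi' a (\<sigma> * t) * \<sigma> * t powr (3 * a)) (at t)"
      unfolding P_def using that by (intro DERIV_mult has_real_derivative_powr) auto
    moreover have "t powr (3 * a) = t powr (3 * a - 1) * t"
      using that by (simp add: powr_diff)
    ultimately have "(P has_real_derivative
        t powr (3 * a - 1) * (3 * a * tricomi a (\<sigma> * t) + (\<sigma> * t) * tricomi' a (\<sigma> * t))) (at t)"
      by (simp add: algebra_simps)
    then show ?thesis
      unfolding tricomi_euler_operator P'_def c_def by (simp add: algebra_simps)
  qed
  have bd: "\<bar>P' t\<bar> \<le> \<bar>c\<bar> * C / t ^ 4" if "t \<ge> 1" for t
  proof -
    have "\<bar>P' t\<bar> \<le> \<bar>c\<bar> * t powr (3 * a - 1) * (C * t powr (- 3 * (a + 1)))"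
      unfolding P'_def abs_mult using bound[OF that] by (auto intro!: mult_left_mono)
    also have "\<dots> = \<bar>c\<bar> * C * t powr (3 * a - 1 + - 3 * (a + 1))"
      unfolding powr_add by simp
    also have "3 * a - 1 + - 3 * (a + 1) = - real 4" by simp
    also have "t powr - real 4 = 1 / t ^ 4"
      using that by (subst powr_minus, subst powr_realpow) (auto simp: divide_simps)
    finally show ?thesis by simp
  qed
  show ?lim
    using tendsto_at_top_of_derivative_bound(1)[OF der bd] unfolding P_def .
  obtain B where B: "\<And>t. t \<ge> 1 \<Longrightarrow> \<bar>P t\<bar> \<le> B"
    using tendsto_at_top_of_derivative_bound(2)[OF der bd] by blast
  have "\<bar>tricomi a (\<sigma> * t)\<bar> \<le> B * t powr (- 3 * a)" if "t \<ge> 1" for t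
  proof -
    have "\<bar>tricomi a (\<sigma> * t)\<bar> = \<bar>P t\<bar> * t powr (- 3 * a)"
      using that by (simp add: P_def abs_mult powr_minus)
    then show ?thesis using B[OF that] by (simp add: mult_right_mono)
  qed
  then show ?bdd by blast
qed

text \<open>For \<open>t > 0\<close> the differential equation is damped, so an energy estimate suffices: the
  components \<open>P = t\<^sup>3\<^sup>a U\<close> and \<open>Q = t\<^sup>3\<^sup>a (- a U - t U' / 3)\<close> satisfy \<open>P' = - 3 Q / t\<close> and
  \<open>Q' = 3 a (a + 1/3) P / t + ((6 a + 1) / t - t\<^sup>2 / 3) Q\<close>.\<close>

lemma tricomi_bound_at_top: "\<exists>B. \<forall>t\<ge>1. \<bar>tricomi a t\<bar> \<le> B * t powr (- 3 * a)"
proof -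
  define P where "P = (\<lambda>t. t powr (3 * a) * tricomi a t)"
  define Q where "Q = (\<lambda>t. t powr (3 * a) * (- a * tricomi a t - t * tricomi' a t / 3))"
  \<comment> \<open>This is the coefficient of P Q / t in the derivative of P^2 + Q^2.\<close>
  define \<kappa> where "\<kappa> = 6 * a * (a + 1/3) - 6"
  \<comment> \<open>The exponential has logarithmic derivative -\<open>\<kappa>\<close>^2/(2 t^4),
    which compensates what remains of the cross term; it is at least 1, so W still dominates
    P^2.\<close>
  define W where "W = (\<lambda>t. ((P t)\<^sup>2 + (Q t)\<^sup>2) * exp (\<kappa>\<^sup>2 / (6 * t ^ 3)))"
  \<comment> \<open>Beyond T one has (6a + 1)/t <= t^2/12, so that the damping of Q^2 keeps at least
    the strength t^2/2.\<close>
  define T where "T = 1 + 12 * \<bar>6 * a + 1\<bar>"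
  have "T \<ge> 1" by (simp add: T_def)
  have dP: "(P has_real_derivative - 3 * Q t / t) (at t)" if "t > 0" for t
  proof -
    have "(P has_real_derivative
        3 * a * t powr (3 * a - 1) * tricomi a t + tricomi' a t * t powr (3 * a)) (at t)"
      unfolding P_def using that
      by (intro DERIV_mult has_real_derivative_powr has_real_derivative_tricomi) auto
    moreover have "t powr (3 * a - 1) = t powr (3 * a) / t"
      using that by (simp add: powr_diff)
    moreover have "3 * a * (t powr (3 * a) / t) * tricomi a t + tricomi' a t * t powr (3 * a) = - 3 * Q t / t"
      using that by (simp add: Q_def field_simps)
    ultimately show ?thesis by (simp only:)
  qed
  have dQ: "(Q has_real_derivative 3 * a * (a + 1/3) * P t / t + ((6 * a + 1) / t - t\<^sup>2 / 3) * Q t) (at t)"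
    if "t > 0" for t
  proof -
    define p where "p = t powr (3 * a)"
    define f where "f = tricomi a t"
    define g where "g = tricomi' a t"
    have "((\<lambda>t. - a * tricomi a t - t * tricomi' a t / 3) has_real_derivative
        - a * g - (t * (- (t\<^sup>2) / 3 * g - a * t * f) + 1 * g) / 3) (at t)"
      unfolding f_def g_def
      by (intro DERIV_diff DERIV_cmult DERIV_cdivide DERIV_mult' DERIV_ident
          has_real_derivative_tricomi has_real_derivative_tricomi')
    then have "(Q has_real_derivative
        3 * a * t powr (3 * a - 1) * (- a * f - t * g / 3)
        + (- a * g - (t * (- (t\<^sup>2) / 3 * g - a * t * f) + 1 * g) / 3) * t powr (3 * a)) (at t)"
      unfolding Q_def f_def g_def using that
      by (intro DERIV_mult has_real_derivative_powr) auto
    moreover have "t powr (3 * a - 1) = p / t"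
      using that by (simp add: powr_diff p_def)
    moreover have "3 * a * (p / t) * (- a * f - t * g / 3)
        + (- a * g - (t * (- (t\<^sup>2) / 3 * g - a * t * f) + 1 * g) / 3) * p
      = 3 * a * (a + 1/3) * (p * f) / t + ((6 * a + 1) / t - t\<^sup>2 / 3) * (p * (- a * f - t * g / 3))"
      using that by (simp add: field_simps power2_eq_square)
    ultimately show ?thesis by (simp add: P_def Q_def p_def f_def g_def)
  qed
  have am_gm: "v \<le> u / 2 + w / 2" if "y\<^sup>2 = u - 2 * v + w" for u v w y :: real
    using zero_le_power2[of y] that by simp
  have W_mono: "W t \<le> W T" if "t \<ge> T" for t
  proof (rule DERIV_nonpos_imp_nonincreasing[OF that])
    fix x assume "T \<le> x" "x \<le> t"
    then have x: "x \<ge> T" "x \<ge> 1" "x > 0" using \<open>T \<ge> 1\<close> by auto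
    define e where "e = exp (\<kappa>\<^sup>2 / (6 * x ^ 3))"
    define p where "p = P x"
    define q where "q = Q x"
    define E' where "E' = 2 * p * (- 3 * q / x)
      + 2 * q * (3 * a * (a + 1/3) * p / x + ((6 * a + 1) / x - x\<^sup>2 / 3) * q)"
    have de: "((\<lambda>t. exp (\<kappa>\<^sup>2 / (6 * t ^ 3))) has_real_derivative e * (- \<kappa>\<^sup>2 / (2 * x ^ 4))) (at x)"
      unfolding e_def using x
      by (auto intro!: derivative_eq_intros simp: field_simps power_eq_if)
    have dE: "((\<lambda>t. (P t)\<^sup>2 + (Q t)\<^sup>2) has_real_derivative E') (at x)"
      unfolding E'_def p_def q_def using dP[OF x(3)] dQ[OF x(3)]
      by (auto intro!: derivative_eq_intros)
    have dW: "(W has_real_derivative E' * e + e * (- \<kappa>\<^sup>2 / (2 * x ^ 4)) * (p\<^sup>2 + q\<^sup>2)) (at x)"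
      unfolding W_def using DERIV_mult[OF dE de] by (simp add: e_def p_def q_def)
    have "E' \<le> \<kappa>\<^sup>2 / (2 * x ^ 4) * (p\<^sup>2 + q\<^sup>2)"
    proof -
      have E': "E' = \<kappa> * p * q / x + 2 * ((6 * a + 1) / x - x\<^sup>2 / 3) * q\<^sup>2"
        using x by (simp add: E'_def \<kappa>_def field_simps power2_eq_square)
      \<comment> \<open>The square splits the cross term with weights x and 1/x^2: the q^2 part is
        absorbed by the damping, and the p^2 part has the integrable factor
        \<open>\<kappa>\<close>^2/(2 x^4).\<close>
      have "(x * q - \<kappa> * p / x\<^sup>2)\<^sup>2 = x\<^sup>2 * q\<^sup>2 - 2 * (\<kappa> * p * q / x) + \<kappa>\<^sup>2 * p\<^sup>2 / x ^ 4"
        using x by (simp add: field_simps power2_eq_square power_eq_if)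
      then have "\<kappa> * p * q / x \<le> x\<^sup>2 * q\<^sup>2 / 2 + \<kappa>\<^sup>2 * p\<^sup>2 / x ^ 4 / 2"
        by (rule am_gm)
      moreover have "2 * ((6 * a + 1) / x - x\<^sup>2 / 3) * q\<^sup>2 \<le> (- (x\<^sup>2) / 2) * q\<^sup>2"
      proof (rule mult_right_mono)
        have "12 * (6 * a + 1) \<le> x * 1"
          using x(1) abs_ge_self[of "6 * a + 1"] unfolding T_def by argo
        also have "x * 1 \<le> x * x\<^sup>2" using x by (intro mult_left_mono) auto
        finally have "(6 * a + 1) / x \<le> x\<^sup>2 / 12"
          using x by (simp add: field_simps power2_eq_square)
        then show "2 * ((6 * a + 1) / x - x\<^sup>2 / 3) \<le> - (x\<^sup>2) / 2" by argo
      qed simp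
      ultimately have "E' \<le> \<kappa>\<^sup>2 * p\<^sup>2 / x ^ 4 / 2" unfolding E' by simp
      also have "\<dots> = \<kappa>\<^sup>2 / (2 * x ^ 4) * p\<^sup>2" by simp
      also have "\<dots> \<le> \<kappa>\<^sup>2 / (2 * x ^ 4) * (p\<^sup>2 + q\<^sup>2)"
        by (intro mult_left_mono) auto
      finally show ?thesis .
    qed
    then have "e * E' \<le> e * (\<kappa>\<^sup>2 / (2 * x ^ 4) * (p\<^sup>2 + q\<^sup>2))"
      by (intro mult_left_mono) (auto simp: e_def)
    then show "\<exists>y. (W has_real_derivative y) (at x) \<and> y \<le> 0"
      using dW by (intro exI conjI) (auto simp: mult_ac)
  qed
  have tail: "\<bar>P t\<bar> \<le> sqrt (W T)" if "t \<ge> T" for t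
  proof -
    have "(P t)\<^sup>2 * 1 \<le> W t"
      unfolding W_def using that \<open>T \<ge> 1\<close> by (intro mult_mono) auto
    then have "(P t)\<^sup>2 \<le> W T" using W_mono[OF that] by simp
    then show ?thesis by (metis real_sqrt_abs real_sqrt_le_mono)
  qed
  have "continuous_on {1..T} P"
    unfolding P_def by (intro continuous_intros) auto
  then have "bounded (P ` {1..T})"
    by (intro compact_imp_bounded compact_continuous_image) auto
  then obtain B where "\<forall>y\<in>P ` {1..T}. norm y \<le> B"
    unfolding bounded_iff by blast
  then have B: "\<bar>P t\<bar> \<le> B" if "t \<in> {1..T}" for t
    using that by auto
  have "\<bar>tricomi a t\<bar> \<le> max B (sqrt (W T)) * t powr (- 3 * a)" if "t \<ge> 1" for t
  proof -
    have "\<bar>P t\<bar> \<le> max B (sqrt (W T))"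
      using tail[of t] B[of t] that by (cases "t \<ge> T") auto
    moreover have "\<bar>tricomi a t\<bar> = \<bar>P t\<bar> * t powr (- 3 * a)"
      using that by (simp add: P_def abs_mult powr_minus)
    ultimately show ?thesis by (simp add: mult_right_mono)
  qed
  then show ?thesis by blast
qed

subsection \<open>The Laplace integral\<close>

lemma Gamma_integral_scaled:
  fixes s z :: real
  assumes s: "s > 0" and z: "z > 0"
  shows "((\<lambda>u. exp (- z * u) * u powr (s - 1)) has_integral Gamma s * z powr (- s)) {0<..}"
proof -
  define f where "f = (\<lambda>t::real. t powr (s - 1) / exp t)"
  have "(f has_integral Gamma s) {0..}"
    unfolding f_def by (rule Gamma_integral_real[OF s])
  then have "(f has_integral Gamma s) {0<..}"
    by (subst has_integral_spike_set_eq[where T = "{0..}"])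
       (auto intro: negligible_subset[OF negligible_sing[of 0]])
  then have f: "f absolutely_integrable_on {0<..}" "integral {0<..} f = Gamma s"
    by (auto intro!: nonnegative_absolutely_integrable_1 simp: f_def has_integral_iff)
  have img: "(*) z ` {0<..} = {0<..}"
  proof safe
    fix x :: real assume "x > 0"
    then show "x \<in> (*) z ` {0<..}" using z by (intro image_eqI[of _ _ "x / z"]) auto
  qed (use z in auto)
  have inj: "inj_on ((*) z) {0<..}" using z by (auto intro!: inj_onI)
  have "(\<lambda>u. \<bar>z\<bar> * f (z * u)) absolutely_integrable_on {0<..} \<and>
      integral {0<..} (\<lambda>u. \<bar>z\<bar> * f (z * u)) = Gamma s"
    using has_absolute_integral_change_of_variables_1'[of "{0<..}" "(*) z" "\<lambda>_. z" f "Gamma s"] f z inj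
    unfolding img by (auto intro!: derivative_eq_intros)
  then have "((\<lambda>u. z powr (- s) * (\<bar>z\<bar> * f (z * u))) has_integral z powr (- s) * Gamma s) {0<..}"
    by (intro has_integral_mult_right) (auto simp: has_integral_iff absolutely_integrable_on_def)
  moreover have "z powr (- s) * (\<bar>z\<bar> * f (z * u)) = exp (- z * u) * u powr (s - 1)"
    if "u \<in> {0<..}" for u
  proof -
    have "z powr (- s) * z * z powr (s - 1) = 1"
      using z by (simp add: powr_minus powr_diff field_simps)
    then show ?thesis
      using that z by (simp add: f_def powr_mult exp_minus field_simps)
  qed
  ultimately show ?thesis
    by (subst has_integral_cong[symmetric]) (auto simp: mult.commute)
qed

text \<open>Integrand of the Laplace representation of Gamma(s) U(s, s + 1 - c, z). Keeping c
  separate from s turns differentiation in z into a shift of s alone; s = a and c = a + 1/3 give the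
  second parameter 2/3.\<close>

definition laplace_kernel :: "real \<Rightarrow> real \<Rightarrow> real \<Rightarrow> real \<Rightarrow> real" where
  "laplace_kernel s c z u = exp (- z * u) * u powr (s - 1) * (1 + u) powr (- c)"

definition laplace_tricomi :: "real \<Rightarrow> real \<Rightarrow> real \<Rightarrow> real" where
  "laplace_tricomi s c z = integral {0<..} (laplace_kernel s c z)"

lemma laplace_kernel_nonneg: "u > 0 \<Longrightarrow> laplace_kernel s c z u \<ge> 0"
  by (simp add: laplace_kernel_def)

lemma laplace_kernel_le:
  assumes "c \<ge> 0" "u > 0"
  shows "laplace_kernel s c z u \<le> exp (- z * u) * u powr (s - 1)"
proof -
  have "(1 + u) powr (- c) \<le> (1 + u) powr 0"
    using assms by (intro powr_mono) auto
  then have "exp (- z * u) * u powr (s - 1) * (1 + u) powr (- c) \<le> exp (- z * u) * u powr (s - 1) * 1"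
    using assms by (intro mult_left_mono) auto
  then show ?thesis by (simp add: laplace_kernel_def)
qed

lemma continuous_on_laplace_kernel: "continuous_on {0<..} (laplace_kernel s c z)"
  unfolding laplace_kernel_def by (intro continuous_intros) auto

lemma laplace_kernel_absolutely_integrable:
  assumes "s > 0" "c \<ge> 0" "z > 0"
  shows "laplace_kernel s c z absolutely_integrable_on {0<..}"
proof (rule measurable_bounded_by_integrable_imp_absolutely_integrable)
  show "laplace_kernel s c z \<in> borel_measurable (lebesgue_on {0<..})"
    by (intro continuous_imp_measurable_on_sets_lebesgue continuous_on_laplace_kernel) auto
  show "(\<lambda>u. exp (- z * u) * u powr (s - 1)) integrable_on {0<..}"
    using Gamma_integral_scaled[OF assms(1,3)] by blast
  show "norm (laplace_kernel s c z u) \<le> exp (- z * u) * u powr (s - 1)" if "u \<in> {0<..}" for u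
    using laplace_kernel_le[of c u] laplace_kernel_nonneg[of u] that assms by simp
qed auto

lemma has_integral_laplace_kernel:
  assumes "s > 0" "c \<ge> 0" "z > 0"
  shows "(laplace_kernel s c z has_integral laplace_tricomi s c z) {0<..}"
  unfolding laplace_tricomi_def using laplace_kernel_absolutely_integrable[OF assms]
  by (auto simp: absolutely_integrable_on_def)

text \<open>Dropping the factor (1 + u)^(-c) <= 1 leaves a Gamma integral. The resulting decay
  z^(-s) is what excludes exponential growth of \<open>tricomi\<close> at minus infinity.\<close>

lemma laplace_tricomi_bounds:
  assumes "s > 0" "c \<ge> 0" "z > 0"
  shows "0 \<le> laplace_tricomi s c z" "laplace_tricomi s c z \<le> Gamma s * z powr (- s)"
proof -
  show "0 \<le> laplace_tricomi s c z"
    by (rule has_integral_nonneg[OF has_integral_laplace_kernel[OF assms]])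
       (auto intro: laplace_kernel_nonneg)
  show "laplace_tricomi s c z \<le> Gamma s * z powr (- s)"
    by (rule has_integral_le[OF has_integral_laplace_kernel[OF assms] Gamma_integral_scaled])
       (use assms laplace_kernel_le in auto)
qed

text \<open>Differentiation under the integral sign through a second-order remainder: |e^x - 1 - x|
  <= e^|x| x^2 bounds the error of the linear approximation by a constant times h^2.\<close>

lemma has_real_derivative_laplace_tricomi:
  assumes s: "s > 0" and c: "c \<ge> 0" and z: "z > 0"
  shows "(laplace_tricomi s c has_real_derivative - laplace_tricomi (s + 1) c z) (at z)"
proof -
  \<comment> \<open>For |h| < z/2 the remainder costs half of the exponential decay, hence z/2, and
    its factor u^2 raises s by 2.\<close>
  define K where "K = laplace_tricomi (s + 2) c (z / 2)"
  have exp_bound: "\<bar>exp x - 1 - x\<bar> \<le> exp \<bar>x\<bar> * x\<^sup>2" for x :: real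
    using Taylor_exp_field[of x 1] by (simp add: algebra_simps power2_eq_square)
  have quad: "\<bar>laplace_tricomi s c (z + h) - laplace_tricomi s c z + h * laplace_tricomi (s + 1) c z\<bar> \<le> h\<^sup>2 * K"
    if h: "\<bar>h\<bar> < z / 2" for h
  proof -
    have zh: "z + h > 0" using h z by linarith
    have "((\<lambda>u. laplace_kernel s c (z + h) u - laplace_kernel s c z u + h * laplace_kernel (s + 1) c z u)
        has_integral laplace_tricomi s c (z + h) - laplace_tricomi s c z + h * laplace_tricomi (s + 1) c z) {0<..}"
      using s c z zh
      by (intro has_integral_add has_integral_diff has_integral_mult_right has_integral_laplace_kernel) auto
    moreover have "((\<lambda>u. h\<^sup>2 * laplace_kernel (s + 2) c (z / 2) u) has_integral h\<^sup>2 * K) {0<..}"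
      unfolding K_def using s c z by (intro has_integral_mult_right has_integral_laplace_kernel) auto
    moreover have "norm (laplace_kernel s c (z + h) u - laplace_kernel s c z u + h * laplace_kernel (s + 1) c z u)
        \<le> h\<^sup>2 * laplace_kernel (s + 2) c (z / 2) u" if "u \<in> {0<..}" for u
    proof -
      have u: "u > 0" using that by simp
      define w where "w = u powr (s - 1) * (1 + u) powr (- c)"
      have w: "w \<ge> 0" by (simp add: w_def)
      have p1: "u powr s = u powr (s - 1) * u" "u powr (s + 1) = u powr (s - 1) * u\<^sup>2"
        using u by (simp_all add: powr_diff powr_add field_simps power2_eq_square)
      have "laplace_kernel s c (z + h) u - laplace_kernel s c z u + h * laplace_kernel (s + 1) c z u
          = w * (exp (- (z + h) * u) - exp (- z * u) + h * u * exp (- z * u))"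
        by (simp add: laplace_kernel_def w_def p1 algebra_simps)
      also have "exp (- (z + h) * u) = exp (- z * u) * exp (- h * u)"
        by (simp add: exp_add[symmetric] algebra_simps)
      finally have eq: "laplace_kernel s c (z + h) u - laplace_kernel s c z u + h * laplace_kernel (s + 1) c z u
          = w * exp (- z * u) * (exp (- h * u) - 1 - (- h * u))"
        by (simp add: algebra_simps)
      have "\<bar>exp (- h * u) - 1 - (- h * u)\<bar> \<le> exp \<bar>- h * u\<bar> * (- h * u)\<^sup>2"
        by (rule exp_bound)
      also have "\<dots> \<le> exp (z / 2 * u) * (- h * u)\<^sup>2"
        using h u by (intro mult_right_mono) (auto simp: abs_mult)
      finally have "\<bar>exp (- h * u) - 1 - (- h * u)\<bar> \<le> exp (z / 2 * u) * (- h * u)\<^sup>2" .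
      then have "\<bar>w * exp (- z * u) * (exp (- h * u) - 1 - (- h * u))\<bar>
          \<le> w * exp (- z * u) * (exp (z / 2 * u) * (- h * u)\<^sup>2)"
        using w by (simp only: abs_mult[of "w * _"] abs_mult[of w] abs_of_nonneg abs_exp_cancel)
          (intro mult_left_mono, auto)
      also have "\<dots> = h\<^sup>2 * (w * u\<^sup>2 * (exp (- z * u) * exp (z / 2 * u)))"
        by (simp add: power_mult_distrib)
      also have "exp (- z * u) * exp (z / 2 * u) = exp (- (z / 2) * u)"
        by (simp add: exp_add[symmetric])
      also have "w * u\<^sup>2 * exp (- (z / 2) * u) = laplace_kernel (s + 2) c (z / 2) u"
        using p1 by (simp add: laplace_kernel_def w_def add.commute)
      finally show ?thesis unfolding eq by simp
    qed
    ultimately show ?thesis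
      by (metis (no_types, lifting) has_integral_integrable has_integral_iff integral_norm_bound_integral real_norm_def)
  qed
  have "((\<lambda>h. (laplace_tricomi s c (z + h) - laplace_tricomi s c z) / h - (- laplace_tricomi (s + 1) c z)) \<longlongrightarrow> 0) (at 0)"
  proof (rule Lim_null_comparison)
    have "\<forall>\<^sub>F h in at 0. h \<in> ball 0 (z / 2) - {0}"
      using z by (intro eventually_at_in_open) auto
    then show "\<forall>\<^sub>F h in at 0. norm ((laplace_tricomi s c (z + h) - laplace_tricomi s c z) / h
        - (- laplace_tricomi (s + 1) c z)) \<le> \<bar>h\<bar> * K"
    proof eventually_elim
      case (elim h)
      then have h: "\<bar>h\<bar> < z / 2" "h \<noteq> 0" by auto
      have "(laplace_tricomi s c (z + h) - laplace_tricomi s c z) / h - (- laplace_tricomi (s + 1) c z)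
          = (laplace_tricomi s c (z + h) - laplace_tricomi s c z + h * laplace_tricomi (s + 1) c z) / h"
        using h by (simp add: field_simps)
      moreover have "\<bar>\<dots>\<bar> \<le> h\<^sup>2 * K / \<bar>h\<bar>"
        unfolding abs_divide using quad[OF h(1)] by (intro divide_right_mono) auto
      moreover have "h\<^sup>2 * K / \<bar>h\<bar> = \<bar>h\<bar> * K"
        using h by (simp add: field_simps power2_eq_square abs_if)
      ultimately show ?case by simp
    qed
    show "((\<lambda>h. \<bar>h\<bar> * K) \<longlongrightarrow> 0) (at 0)"
      by (auto intro!: tendsto_eq_intros)
  qed
  then show ?thesis
    unfolding DERIV_def by (rule LIM_zero_cancel)
qed

text \<open>The substitution u = s/(1 - s) carries the Beta integral from (0, 1) to the half-line.
  The integrand is the Laplace kernel at z = 0.\<close>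

lemma has_integral_Beta_halfline:
  fixes p q :: real
  assumes p: "p > 0" and q: "q > 0"
  shows "((\<lambda>u. u powr (p - 1) * (1 + u) powr (- (p + q))) has_integral Beta p q) {0<..}"
proof -
  define f where "f = (\<lambda>u::real. u powr (p - 1) * (1 + u) powr (- (p + q)))"
  define g where "g = (\<lambda>s::real. s / (1 - s))"
  define g' where "g' = (\<lambda>s::real. 1 / (1 - s)\<^sup>2)"
  have der: "(g has_field_derivative g' s) (at s within {0<..<1})" if "s \<in> {0<..<1}" for s
    using that unfolding g_def g'_def
    by (auto intro!: derivative_eq_intros simp: field_simps power2_eq_square)
  have inj: "inj_on g {0<..<1}"
    by (rule inj_onI) (auto simp: g_def field_simps)
  have img: "g ` {0<..<1} = {0<..}"
  proof safe
    fix u :: real assume "u > 0"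
    then show "u \<in> g ` {0<..<1}"
      by (intro image_eqI[of _ _ "u / (1 + u)"]) (auto simp: g_def field_simps)
  qed (auto simp: g_def)
  have eq: "\<bar>g' s\<bar> * f (g s) = s powr (p - 1) * (1 - s) powr (q - 1)" if "s \<in> {0<..<1}" for s
  proof -
    have "1 + g s = inverse (1 - s)" using that by (simp add: g_def field_simps)
    then have "f (g s) = (s / (1 - s)) powr (p - 1) * inverse (1 - s) powr (- (p + q))"
      by (simp add: f_def g_def)
    also have "(s / (1 - s)) powr (p - 1) = s powr (p - 1) * (1 - s) powr (- (p - 1))"
      by (simp only: divide_inverse powr_mult inverse_powr powr_minus)
    also have "inverse (1 - s) powr (- (p + q)) = (1 - s) powr (p + q)"
      unfolding inverse_powr powr_minus by simp
    finally have "f (g s) = s powr (p - 1) * ((1 - s) powr (- (p - 1)) * (1 - s) powr (p + q))"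
      by (simp only: mult.assoc)
    also have "(1 - s) powr (- (p - 1)) * (1 - s) powr (p + q) = (1 - s) powr (q - 1 + 2)"
      by (simp add: powr_add[symmetric])
    also have "\<dots> = (1 - s) powr (q - 1) * (1 - s)\<^sup>2"
      using that by (simp only: powr_add) simp
    finally show ?thesis using that by (simp add: g'_def)
  qed
  have "((\<lambda>s. s powr (p - 1) * (1 - s) powr (q - 1)) has_integral Beta p q) {0<..<1}"
    using has_integral_Beta_real[OF p q] by (simp add: has_integral_Icc_iff_Ioo)
  then have "((\<lambda>s. \<bar>g' s\<bar> * f (g s)) has_integral Beta p q) {0<..<1}"
    using eq by (subst has_integral_cong) auto
  moreover have "f (g s) \<ge> 0" if "s \<in> {0<..<1}" for s using that by (auto simp: f_def g_def)
  ultimately have "(\<lambda>s. \<bar>g' s\<bar> * f (g s)) absolutely_integrable_on {0<..<1} \<and>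
      integral {0<..<1} (\<lambda>s. \<bar>g' s\<bar> * f (g s)) = Beta p q"
    by (auto intro!: nonnegative_absolutely_integrable_1 simp: has_integral_iff)
  then have "f absolutely_integrable_on {0<..} \<and> integral {0<..} f = Beta p q"
    using has_absolute_integral_change_of_variables_1'[of "{0<..<1}" g g' f "Beta p q"] der inj
    unfolding img by auto
  then show ?thesis
    unfolding f_def by (auto simp: has_integral_iff absolutely_integrable_on_def)
qed

text \<open>The difference of the two sides is, up to sign, the integral of the derivative of F(u) =
  e^(-z u) u^a (1 + u)^(1 - c), which vanishes at 0 because a > 0 and at infinity because z > 0.
  This is Kummer's equation with derivatives written as shifts of s.\<close>

lemma laplace_tricomi_ode:
  assumes a: "a > 0" and z: "z > 0"
  shows "z * laplace_tricomi (a + 2) (a + 1/3) z + z * laplace_tricomi (a + 1) (a + 1/3) z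
    = a * laplace_tricomi a (a + 1/3) z + 2/3 * laplace_tricomi (a + 1) (a + 1/3) z"
proof -
  define c where "c = a + 1/3"
  define F where "F = (\<lambda>u. exp (- z * u) * u powr a * (1 + u) powr (1 - c))"
  define f where "f = (\<lambda>u. a * laplace_kernel a c z u + 2/3 * laplace_kernel (a + 1) c z u
    - (z * laplace_kernel (a + 2) c z u + z * laplace_kernel (a + 1) c z u))"
  have c: "c \<ge> 0" using a by (simp add: c_def)
  have abs_int: "f absolutely_integrable_on {0<..}"
    unfolding f_def using a z c
    by (intro set_integral_diff set_integral_add set_integrable_mult_right laplace_kernel_absolutely_integrable) auto
  have int: "(f has_integral a * laplace_tricomi a c z + 2/3 * laplace_tricomi (a + 1) c z
    - (z * laplace_tricomi (a + 2) c z + z * laplace_tricomi (a + 1) c z)) {0<..}"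
    unfolding f_def using a z c
    by (intro has_integral_diff has_integral_add has_integral_mult_right has_integral_laplace_kernel) auto
  have cont: "continuous_on {0<..} f"
    unfolding f_def by (intro continuous_intros continuous_on_laplace_kernel)
  \<comment> \<open>Continuity gives Borel measurability, which takes integrability from the
    completed Lebesgue measure to \<open>lborel\<close>, where the fundamental theorem is
    applied.\<close>
  have "(\<lambda>u. indicator {0<..} u *\<^sub>R f u) \<in> borel_measurable borel"
    using cont by (intro borel_measurable_continuous_on_indicator) auto
  then have lborel_int: "set_integrable lborel {0<..} f"
    using abs_int unfolding set_integrable_def by (subst (asm) integrable_completion) auto
  have "(LBINT u=0..\<infinity>. f u) = 0 - 0"
  proof (rule interval_integral_FTC_integrable)
    fix u assume "0 < ereal u"
    then have u: "u > 0" by simp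
    define w where "w = u powr (a - 1)"
    define w1 where "w1 = (1 + u) powr (- c)"
    have p: "u powr a = w * u" "u powr (1 + a) = w * u\<^sup>2" "(1 + u) powr (1 - c) = w1 * (1 + u)"
      using u by (simp_all add: w_def w1_def powr_diff powr_add powr_minus field_simps power2_eq_square)
    have "(F has_real_derivative
        (exp (- z * u) * (- z) * u powr a + exp (- z * u) * (a * u powr (a - 1))) * (1 + u) powr (1 - c)
        + exp (- z * u) * u powr a * ((1 - c) * (1 + u) powr (- c))) (at u)"
      unfolding F_def using u by (auto intro!: derivative_eq_intros)
    also have "(exp (- z * u) * (- z) * u powr a + exp (- z * u) * (a * u powr (a - 1))) * (1 + u) powr (1 - c)
        + exp (- z * u) * u powr a * ((1 - c) * (1 + u) powr (- c)) = f u"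
      unfolding f_def laplace_kernel_def
      by (simp add: p w_def[symmetric] w1_def[symmetric] add.commute[of a 1])
         (simp add: c_def algebra_simps power2_eq_square)
    finally show "(F has_vector_derivative f u) (at u)"
      by (simp add: has_real_derivative_iff_has_vector_derivative)
    show "isCont f u"
      using cont u by (simp add: continuous_on_eq_continuous_at)
  next
    have "(F \<longlongrightarrow> 0) (at_right 0)"
      unfolding F_def using a z by real_asymp
    then show "((F \<circ> real_of_ereal) \<longlongrightarrow> 0) (at_right 0)"
      by (simp add: zero_ereal_def ereal_tendsto_simps)
    have "(F \<longlongrightarrow> 0) at_top"
      unfolding F_def using a z by real_asymp
    then show "((F \<circ> real_of_ereal) \<longlongrightarrow> 0) (at_left \<infinity>)"
      by (simp add: ereal_tendsto_simps)
    show "set_integrable lborel (einterval 0 \<infinity>) f"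
      using lborel_int by (simp add: zero_ereal_def)
  qed auto
  then have "integral {0<..} f = 0"
    unfolding interval_lebesgue_integral_0_infty using set_borel_integral_eq_integral(2)[OF lborel_int] by simp
  then show ?thesis
    using int unfolding c_def by (simp add: has_integral_iff)
qed

section \<open>Behaviour of the Laplace integral as z tends to 0\<close>

lemma one_minus_exp_le_powr:
  fixes x \<delta> :: real
  assumes "x > 0" "0 \<le> \<delta>" "\<delta> \<le> 1"
  shows "1 - exp (- x) \<le> x powr \<delta>"
proof (cases "x \<le> 1")
  case True
  have "1 - exp (- x) \<le> x powr 1" using exp_ge_add_one_self[of "- x"] assms by simp
  also have "\<dots> \<le> x powr \<delta>" using assms True by (intro powr_mono') auto
  finally show ?thesis .
next
  case False
  have "1 - exp (- x) \<le> 1" by simp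
  also have "\<dots> \<le> x powr \<delta>" using assms False by (intro ge_one_powr_ge_zero) auto
  finally show ?thesis .
qed

lemma laplace_tricomi_tendsto_at_0:
  assumes a: "a > 0"
  shows "(laplace_tricomi a (a + 1/3) \<longlongrightarrow> Beta a (1/3)) (at_right 0)"
proof -
  have bound: "\<bar>laplace_tricomi a (a + 1/3) z - Beta a (1/3)\<bar> \<le> z powr (1/6) * Beta (a + 1/6) (1/6)"
    if z: "z > 0" for z
  proof -
    define k0 where "k0 = (\<lambda>u::real. u powr (a - 1) * (1 + u) powr (- (a + 1/3)))"
    \<comment> \<open>Replacing e^(-z u) by 1 costs at most (z u)^(1/6). The exponent must stay
      below 1/3, since \<open>k0\<close> decays like u^(-4/3); with 1/6 the bound is again a Beta
      integrand, having the same sum p + q = a + 1/3.\<close>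
    define k1 where "k1 = (\<lambda>u::real. u powr (a + 1/6 - 1) * (1 + u) powr (- (a + 1/6 + 1/6)))"
    have "((\<lambda>u. laplace_kernel a (a + 1/3) z u - k0 u) has_integral
        laplace_tricomi a (a + 1/3) z - Beta a (1/3)) {0<..}"
      unfolding k0_def using a z
      by (intro has_integral_diff has_integral_laplace_kernel has_integral_Beta_halfline) auto
    moreover have "((\<lambda>u. z powr (1/6) * k1 u) has_integral z powr (1/6) * Beta (a + 1/6) (1/6)) {0<..}"
      unfolding k1_def using a by (intro has_integral_mult_right has_integral_Beta_halfline) auto
    moreover have "norm (laplace_kernel a (a + 1/3) z u - k0 u) \<le> z powr (1/6) * k1 u"
      if "u \<in> {0<..}" for u
    proof -
      have u: "u > 0" using that by simp
      have k0: "k0 u \<ge> 0" by (simp add: k0_def)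
      have "laplace_kernel a (a + 1/3) z u - k0 u = - (k0 u * (1 - exp (- (z * u))))"
        by (simp add: laplace_kernel_def k0_def algebra_simps)
      then have "norm (laplace_kernel a (a + 1/3) z u - k0 u) = k0 u * (1 - exp (- (z * u)))"
        using k0 u z by (simp add: abs_mult)
      also have "\<dots> \<le> k0 u * (z * u) powr (1/6)"
        using k0 u z by (intro mult_left_mono one_minus_exp_le_powr) auto
      also have "\<dots> = z powr (1/6) * ((u powr (a - 1) * u powr (1/6)) * (1 + u) powr (- (a + 1/3)))"
        using u z by (simp add: k0_def powr_mult)
      also have "\<dots> = z powr (1/6) * k1 u"
        unfolding powr_add[symmetric] k1_def by (simp add: algebra_simps)
      finally show ?thesis .
    qed
    ultimately show ?thesis
      by (metis (no_types, lifting) has_integral_integrable has_integral_iff integral_norm_bound_integral real_norm_def)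
  qed
  have "((\<lambda>z. laplace_tricomi a (a + 1/3) z - Beta a (1/3)) \<longlongrightarrow> 0) (at_right 0)"
  proof (rule Lim_null_comparison)
    show "\<forall>\<^sub>F z in at_right 0. norm (laplace_tricomi a (a + 1/3) z - Beta a (1/3)) \<le> z powr (1/6) * Beta (a + 1/6) (1/6)"
      using eventually_at_right_less[of 0] by eventually_elim (use bound in auto)
    show "((\<lambda>z. z powr (1/6) * Beta (a + 1/6) (1/6)) \<longlongrightarrow> 0) (at_right 0)"
      by (rule tendsto_mult_left_zero) real_asymp
  qed
  then show ?thesis by (rule LIM_zero_cancel)
qed

text \<open>For large u the algebraic part of the kernel behaves like u^(-1/3), which is not
  integrable without the exponential. Comparison with the integral of e^(-z u) u^(-1/3), equal to
  Gamma(2/3) z^(-2/3), leaves an error O(z^(-1/3)).\<close>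

lemma laplace_tricomi_Suc_tendsto_at_0:
  assumes a: "a > 0"
  shows "((\<lambda>z. z powr (2/3) * laplace_tricomi (a + 1) (a + 1/3) z) \<longlongrightarrow> Gamma (2/3)) (at_right 0)"
proof -
  define c where "c = a + 1/3"
  obtain N :: nat where N: "c \<le> real N" using real_arch_simple by blast
  \<comment> \<open>Bernoulli's inequality for the integer exponent N >= c gives N/(1 + u).
    Weakening this to N u^(-1/3) makes the error kernel e^(-z u) u^(-2/3), a Gamma
    integrand.\<close>
  have bernoulli: "1 - (u / (1 + u)) powr c \<le> real N * u powr (- 1/3)" if u: "u > 0" for u
  proof -
    have "1 - real N * (1 / (1 + u)) \<le> (1 + - (1 / (1 + u))) ^ N"
      using Bernoulli_inequality[of "- (1 / (1 + u))" N] u by (simp add: field_simps)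
    also have "1 + - (1 / (1 + u)) = u / (1 + u)" using u by (simp add: field_simps)
    also have "(u / (1 + u)) ^ N = (u / (1 + u)) powr real N"
      using u by (simp add: powr_realpow)
    also have "\<dots> \<le> (u / (1 + u)) powr c"
      using u N by (intro powr_mono') auto
    finally have "1 - (u / (1 + u)) powr c \<le> real N * (1 / (1 + u))" by simp
    also have "\<dots> \<le> real N * (u powr (- 1/3))"
    proof (intro mult_left_mono)
      have "u powr (1/3) \<le> (1 + u) powr (1/3)" using u by (intro powr_mono2) auto
      also have "\<dots> \<le> (1 + u) powr 1" using u by (intro powr_mono) auto
      finally have "u powr (1/3) \<le> 1 + u" using u by simp
      then have "1 / (1 + u) \<le> 1 / u powr (1/3)" using u by (intro divide_left_mono) auto
      then show "1 / (1 + u) \<le> u powr (- 1/3)" by (simp add: powr_minus_divide)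
    qed simp
    finally show ?thesis .
  qed
  have bound: "\<bar>laplace_tricomi (a + 1) c z - Gamma (2/3) * z powr (- (2/3))\<bar>
      \<le> real N * (Gamma (1/3) * z powr (- (1/3)))" if z: "z > 0" for z
  proof -
    have "((\<lambda>u. laplace_kernel (a + 1) c z u - exp (- z * u) * u powr (2/3 - 1)) has_integral
        laplace_tricomi (a + 1) c z - Gamma (2/3) * z powr (- (2/3))) {0<..}"
      using a z
      by (intro has_integral_diff has_integral_laplace_kernel Gamma_integral_scaled) (auto simp: c_def)
    moreover have "((\<lambda>u. real N * (exp (- z * u) * u powr (1/3 - 1))) has_integral
        real N * (Gamma (1/3) * z powr (- (1/3)))) {0<..}"
      using z by (intro has_integral_mult_right Gamma_integral_scaled) auto
    moreover have "norm (laplace_kernel (a + 1) c z u - exp (- z * u) * u powr (2/3 - 1))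
        \<le> real N * (exp (- z * u) * u powr (1/3 - 1))" if "u \<in> {0<..}" for u
    proof -
      have u: "u > 0" using that by simp
      have le1: "(u / (1 + u)) powr c \<le> 1"
        using u a by (intro powr_le1) (auto simp: c_def)
      have "u powr a = u powr (- 1/3) * u powr c"
        by (simp add: c_def powr_add[symmetric])
      then have "laplace_kernel (a + 1) c z u = exp (- z * u) * (u powr (- 1/3) * (u powr c * (1 + u) powr (- c)))"
        by (simp add: laplace_kernel_def)
      also have "u powr c * (1 + u) powr (- c) = (u / (1 + u)) powr c"
        by (simp only: divide_inverse powr_mult inverse_powr powr_minus)
      finally have "laplace_kernel (a + 1) c z u - exp (- z * u) * u powr (2/3 - 1)
          = - (exp (- z * u) * u powr (- 1/3) * (1 - (u / (1 + u)) powr c))"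
        by (simp add: algebra_simps)
      then have "norm (laplace_kernel (a + 1) c z u - exp (- z * u) * u powr (2/3 - 1))
          = exp (- z * u) * u powr (- 1/3) * (1 - (u / (1 + u)) powr c)"
        using le1 by (simp add: abs_mult)
      also have "\<dots> \<le> exp (- z * u) * u powr (- 1/3) * (real N * u powr (- 1/3))"
        using u by (intro mult_left_mono bernoulli) auto
      also have "\<dots> = real N * (exp (- z * u) * (u powr (- 1/3) * u powr (- 1/3)))" by simp
      also have "u powr (- 1/3) * u powr (- 1/3) = u powr (1/3 - 1)"
        by (simp add: powr_add[symmetric])
      finally show ?thesis .
    qed
    ultimately show ?thesis
      by (metis (no_types, lifting) has_integral_integrable has_integral_iff integral_norm_bound_integral real_norm_def)
  qed
  have "((\<lambda>z. z powr (2/3) * laplace_tricomi (a + 1) c z - Gamma (2/3)) \<longlongrightarrow> 0) (at_right 0)"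
  proof (rule Lim_null_comparison)
    show "\<forall>\<^sub>F z in at_right 0. norm (z powr (2/3) * laplace_tricomi (a + 1) c z - Gamma (2/3))
        \<le> z powr (1/3) * (real N * Gamma (1/3))"
      using eventually_at_right_less[of 0]
    proof eventually_elim
      case (elim z)
      have p: "z powr (2/3) * z powr (- (2/3)) = 1" "z powr (2/3) * z powr (- (1/3)) = z powr (1/3)"
        using elim by (simp_all add: powr_add[symmetric])
      have "z powr (2/3) * laplace_tricomi (a + 1) c z - Gamma (2/3)
          = z powr (2/3) * (laplace_tricomi (a + 1) c z - Gamma (2/3) * z powr (- (2/3)))"
        using p(1) by (simp add: right_diff_distrib mult.left_commute)
      then have "norm (z powr (2/3) * laplace_tricomi (a + 1) c z - Gamma (2/3))
          = z powr (2/3) * \<bar>laplace_tricomi (a + 1) c z - Gamma (2/3) * z powr (- (2/3))\<bar>"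
        by (simp add: abs_mult)
      also have "\<dots> \<le> z powr (2/3) * (real N * (Gamma (1/3) * z powr (- (1/3))))"
        by (intro mult_left_mono bound elim) auto
      also have "\<dots> = (z powr (2/3) * z powr (- (1/3))) * (real N * Gamma (1/3))" by simp
      finally show ?case unfolding p(2) .
    qed
    show "((\<lambda>z. z powr (1/3) * (real N * Gamma (1/3))) \<longlongrightarrow> 0) (at_right 0)"
      by (rule tendsto_mult_left_zero) real_asymp
  qed
  then show ?thesis unfolding c_def by (rule LIM_zero_cancel)
qed

section \<open>Identification of the Laplace integral with Tricomi's function\<close>

lemma linear_ode_unique_at_0:
  fixes D D' :: "real \<Rightarrow> real"
  assumes dD: "\<And>y. y > 0 \<Longrightarrow> (D has_real_derivative D' y) (at y)"
    and dD': "\<And>y. y > 0 \<Longrightarrow> (D' has_real_derivative y\<^sup>2 / 3 * D' y + a * y * D y) (at y)"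
    and lim: "(D \<longlongrightarrow> 0) (at_right 0)" "(D' \<longlongrightarrow> 0) (at_right 0)"
    and a: "a \<ge> 0" and Y: "Y > 0"
  shows "D Y = 0"
proof -
  \<comment> \<open>A Gronwall argument: on (0, Y] the derivative of D^2 + D'^2 is at most
    \<open>K\<close> times that sum, so the weighted energy \<open>W\<close> is nonincreasing there.
    As it tends to 0 at the left end, it vanishes at Y.\<close>
  define K where "K = 1 + a * Y + 2 * Y\<^sup>2 / 3"
  define W where "W = (\<lambda>y. ((D y)\<^sup>2 + (D' y)\<^sup>2) * exp (- K * y))"
  have W_mono: "W Y \<le> W \<epsilon>" if \<epsilon>: "0 < \<epsilon>" "\<epsilon> \<le> Y" for \<epsilon>
  proof (rule DERIV_nonpos_imp_nonincreasing[OF \<epsilon>(2)])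
    fix y assume y': "\<epsilon> \<le> y" "y \<le> Y"
    then have y: "y > 0" using \<epsilon> by simp
    define d where "d = D y"
    define d' where "d' = D' y"
    define E' where "E' = 2 * d * d' + 2 * d' * (y\<^sup>2 / 3 * d' + a * y * d)"
    have dE: "((\<lambda>y. (D y)\<^sup>2 + (D' y)\<^sup>2) has_real_derivative E') (at y)"
      unfolding E'_def d_def d'_def using dD[OF y] dD'[OF y]
      by (auto intro!: derivative_eq_intros)
    have "((\<lambda>y. exp (- K * y)) has_real_derivative exp (- K * y) * (- K)) (at y)"
      by (auto intro!: derivative_eq_intros)
    from DERIV_mult[OF dE this]
    have dW: "(W has_real_derivative exp (- K * y) * (E' - K * (d\<^sup>2 + d'\<^sup>2))) (at y)"
      unfolding W_def d_def d'_def by (simp add: algebra_simps)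
    have "E' = (1 + a * y) * (2 * d * d') + 2 * y\<^sup>2 / 3 * d'\<^sup>2"
      by (simp add: E'_def algebra_simps power2_eq_square)
    also have "\<dots> \<le> (1 + a * y) * (d\<^sup>2 + d'\<^sup>2) + 2 * y\<^sup>2 / 3 * (d\<^sup>2 + d'\<^sup>2)"
      using a y sum_squares_bound[of d d'] by (intro add_mono mult_left_mono) auto
    also have "\<dots> = (1 + a * y + 2 * y\<^sup>2 / 3) * (d\<^sup>2 + d'\<^sup>2)"
      by (simp only: distrib_right)
    also have "\<dots> \<le> K * (d\<^sup>2 + d'\<^sup>2)"
    proof (rule mult_right_mono)
      have "y\<^sup>2 \<le> Y\<^sup>2" "a * y \<le> a * Y"
        using y y' a by (auto intro: power_mono mult_left_mono)
      then show "1 + a * y + 2 * y\<^sup>2 / 3 \<le> K" by (simp add: K_def)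
    qed simp
    finally have "exp (- K * y) * (E' - K * (d\<^sup>2 + d'\<^sup>2)) \<le> 0"
      by (intro mult_nonneg_nonpos) auto
    then show "\<exists>x. (W has_real_derivative x) (at y) \<and> x \<le> 0" using dW by blast
  qed
  have "(W \<longlongrightarrow> (0\<^sup>2 + 0\<^sup>2) * exp (- K * 0)) (at_right 0)"
    unfolding W_def by (intro tendsto_intros lim)
  moreover have "\<forall>\<^sub>F \<epsilon> in at_right 0. W Y \<le> W \<epsilon>"
    using Y W_mono by (auto simp: eventually_at_right[OF Y] intro!: exI[of _ Y])
  ultimately have "W Y \<le> 0"
    by (intro tendsto_lowerbound[of W 0 "at_right 0" "W Y"]) auto
  then have "(D Y)\<^sup>2 + (D' Y)\<^sup>2 \<le> 0"
    by (simp add: W_def mult_le_0_iff)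
  then show ?thesis
    by (simp add: sum_power2_le_zero_iff)
qed

lemma kummerM_0 [simp]: "kummerM a b 0 = 1"
proof -
  have "(\<lambda>n. pochhammer a n / pochhammer b n * 0 ^ n / fact n) = (\<lambda>n. if n = 0 then 1 else 0 :: real)"
    by auto
  then show ?thesis
    using sums_unique[OF sums_single[of 0 "\<lambda>_. 1 :: real"]] by (simp add: kummerM_def)
qed

text \<open>At t = -y the variable zeta = y^3/9 is positive, so the Laplace integral converges. Both
  sides solve the same second-order equation in y, and their values and first derivatives have the
  same limits as y tends to 0 from the right.\<close>

lemma tricomi_eq_laplace:
  assumes a: "a > 0" and y: "y > 0"
  shows "Gamma a * tricomi a (- y) = laplace_tricomi a (a + 1/3) (y ^ 3 / 9)"
proof -
  define c where "c = a + 1/3"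
  define L where "L = (\<lambda>s y. laplace_tricomi s c (y ^ 3 / 9))"
  define D where "D = (\<lambda>y. Gamma a * tricomi a (- y) - L a y)"
  define D' where "D' = (\<lambda>y. - Gamma a * tricomi' a (- y) + y\<^sup>2 / 3 * L (a + 1) y)"
  have c: "c \<ge> 0" using a by (simp add: c_def)
  have Ga: "Gamma a * rGamma a = 1"
    using Gamma_real_pos[OF a] by (simp add: rGamma_inverse_Gamma)
  have dL: "((\<lambda>y. L s y) has_real_derivative - (y\<^sup>2 / 3 * L (s + 1) y)) (at y)"
    if "s > 0" "y > 0" for s y
  proof -
    have "((\<lambda>y. y ^ 3 / 9 :: real) has_real_derivative y\<^sup>2 / 3) (at y)"
      by (auto intro!: derivative_eq_intros)
    from DERIV_chain2[OF has_real_derivative_laplace_tricomi this, of s c] that c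
    show ?thesis by (simp add: L_def mult.commute)
  qed
  have dT: "((\<lambda>y. tricomi a (- y)) has_real_derivative - tricomi' a (- y)) (at y)" for y
    using DERIV_chain2[OF has_real_derivative_tricomi DERIV_minus[OF DERIV_ident]] by simp
  have dT': "((\<lambda>y. tricomi' a (- y)) has_real_derivative
      y\<^sup>2 / 3 * tricomi' a (- y) - a * y * tricomi a (- y)) (at y)" for y
    using DERIV_chain2[OF has_real_derivative_tricomi' DERIV_minus[OF DERIV_ident]]
    by (simp add: algebra_simps)
  have dD: "(D has_real_derivative D' y) (at y)" if "y > 0" for y
    using DERIV_diff[OF DERIV_cmult[OF dT, of "Gamma a"] dL[OF a that]] by (simp add: D_def D'_def)
  have dD': "(D' has_real_derivative y\<^sup>2 / 3 * D' y + a * y * D y) (at y)" if y: "y > 0" for y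
  proof -
    have "((\<lambda>y. y\<^sup>2 / 3 :: real) has_real_derivative 2 * y / 3) (at y)"
      by (auto intro!: derivative_eq_intros)
    from DERIV_add[OF DERIV_cmult[OF dT', of "- Gamma a"] DERIV_mult'[OF this dL[OF _ y, of "a + 1"]]] a
    have "(D' has_real_derivative - Gamma a * (y\<^sup>2 / 3 * tricomi' a (- y) - a * y * tricomi a (- y))
        + (y\<^sup>2 / 3 * - (y\<^sup>2 / 3 * L (a + 2) y) + 2 * y / 3 * L (a + 1) y)) (at y)"
      by (simp add: D'_def add.assoc)
    moreover have "y ^ 3 / 9 * L (a + 2) y + y ^ 3 / 9 * L (a + 1) y = a * L a y + 2/3 * L (a + 1) y"
      unfolding L_def c_def using a y by (intro laplace_tricomi_ode) auto
    \<comment> \<open>Multiplication by y turns y^3/9 into (y^2/3)^2, the square of the chain-rule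
      factor.\<close>
    then have "y * (y ^ 3 / 9 * L (a + 2) y + y ^ 3 / 9 * L (a + 1) y) = y * (a * L a y + 2/3 * L (a + 1) y)"
      by (rule arg_cong)
    then have "y\<^sup>2 / 3 * - (y\<^sup>2 / 3 * L (a + 2) y) + 2 * y / 3 * L (a + 1) y
        = y\<^sup>2 / 3 * (y\<^sup>2 / 3 * L (a + 1) y) - a * y * L a y"
      by (simp add: algebra_simps power2_eq_square power3_eq_cube)
    ultimately have "(D' has_real_derivative - Gamma a * (y\<^sup>2 / 3 * tricomi' a (- y) - a * y * tricomi a (- y))
        + (y\<^sup>2 / 3 * (y\<^sup>2 / 3 * L (a + 1) y) - a * y * L a y)) (at y)"
      by (simp only:)
    also have "- Gamma a * (y\<^sup>2 / 3 * tricomi' a (- y) - a * y * tricomi a (- y))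
        + (y\<^sup>2 / 3 * (y\<^sup>2 / 3 * L (a + 1) y) - a * y * L a y) = y\<^sup>2 / 3 * D' y + a * y * D y"
      by (simp add: D_def D'_def algebra_simps)
    finally show ?thesis .
  qed
  have cube: "filterlim (\<lambda>y::real. y ^ 3 / 9) (at_right 0) (at_right 0)"
    by real_asymp
  have "((\<lambda>y. tricomi a (- y)) \<longlongrightarrow> tricomi a (- 0)) (at_right 0)"
    using DERIV_isCont[OF dT[of 0]] by (simp add: isCont_def filterlim_at_split)
  moreover have "(L a \<longlongrightarrow> Beta a (1/3)) (at_right 0)"
    unfolding L_def c_def by (rule filterlim_compose[OF laplace_tricomi_tendsto_at_0[OF a] cube])
  ultimately have "(D \<longlongrightarrow> Gamma a * tricomi a (- 0) - Beta a (1/3)) (at_right 0)"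
    unfolding D_def by (intro tendsto_intros)
  moreover have "Gamma a * tricomi a (- 0) = Beta a (1/3)"
    by (simp add: tricomi_def Beta_altdef)
  ultimately have lim0: "(D \<longlongrightarrow> 0) (at_right 0)" by simp
  have "((\<lambda>y. tricomi' a (- y)) \<longlongrightarrow> tricomi' a (- 0)) (at_right 0)"
    using DERIV_isCont[OF dT'[of 0]] by (simp add: isCont_def filterlim_at_split)
  \<comment> \<open>The chain-rule factor y^2 equals 9^(2/3) (y^3/9)^(2/3), exactly the power that
    compensates the divergence of \<open>L (a + 1)\<close> at 0.\<close>
  moreover have "((\<lambda>y. 9 powr (2/3) / 3 * ((y ^ 3 / 9) powr (2/3) * L (a + 1) y))
      \<longlongrightarrow> 9 powr (2/3) / 3 * Gamma (2/3)) (at_right 0)"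
    unfolding L_def c_def
    by (intro tendsto_mult tendsto_const filterlim_compose[OF laplace_tricomi_Suc_tendsto_at_0[OF a] cube])
  then have "((\<lambda>y. y\<^sup>2 / 3 * L (a + 1) y) \<longlongrightarrow> 9 powr (2/3) / 3 * Gamma (2/3)) (at_right 0)"
  proof (rule Lim_transform_eventually)
    show "\<forall>\<^sub>F y in at_right 0. 9 powr (2/3) / 3 * ((y ^ 3 / 9) powr (2/3) * L (a + 1) y) = y\<^sup>2 / 3 * L (a + 1) y"
      using eventually_at_right_less[of 0]
    proof eventually_elim
      case (elim y)
      have "9 powr (2/3) * (y ^ 3 / 9) powr (2/3) = (y ^ 3) powr (2/3)"
        using elim by (simp add: powr_mult[symmetric])
      also have "\<dots> = (y powr 3) powr (2/3)"
        using elim by simp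
      also have "\<dots> = y\<^sup>2"
        using elim by (simp only: powr_powr) simp
      finally show ?case by simp
    qed
  qed
  ultimately have "(D' \<longlongrightarrow> - Gamma a * tricomi' a (- 0) + 9 powr (2/3) / 3 * Gamma (2/3)) (at_right 0)"
    unfolding D'_def by (intro tendsto_add tendsto_mult_left)
  \<comment> \<open>The initial slopes agree because Gamma(-1/3) = -3 Gamma(2/3) and 9^(2/3) =
    9/9^(1/3).\<close>
  moreover have "- Gamma a * tricomi' a (- 0) + 9 powr (2/3) / 3 * Gamma (2/3) = 0"
  proof -
    have "- Gamma a * tricomi' a (- 0) = (Gamma a * rGamma a) * Gamma (- 1/3) / 9 powr (1/3)"
      by (simp add: tricomi'_def)
    moreover have "inverse (Gamma (- 1/3)) = inverse (- 3 * Gamma (2/3 :: real))"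
      using rGamma_plus1[of "- 1/3 :: real"] by (simp add: rGamma_inverse_Gamma)
    then have "Gamma (- 1/3) = - 3 * Gamma (2/3 :: real)"
      by (simp only: inverse_eq_iff_eq)
    moreover have "(9::real) powr (2/3) * 9 powr (1/3) = 9"
      by (simp add: powr_add[symmetric])
    then have "(9::real) powr (2/3) = 9 / 9 powr (1/3)"
      by (simp add: nonzero_eq_divide_eq)
    ultimately show ?thesis unfolding Ga by simp
  qed
  ultimately have lim1: "(D' \<longlongrightarrow> 0) (at_right 0)" by simp
  have "D y = 0"
    by (rule linear_ode_unique_at_0[OF dD dD' lim0 lim1]) (use a y in auto)
  then show ?thesis by (simp add: D_def L_def c_def)
qed

section \<open>Asymptotics of Tricomi's function at both ends\<close>

lemma tricomi_bound_at_bot: "\<exists>B. \<forall>t\<ge>1. \<bar>tricomi a (- t)\<bar> \<le> B * t powr (- 3 * a)"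
proof -
  \<comment> \<open>Induction on the number of shifts that make the parameter positive: for a > 0
    the Laplace integral gives the bound with constant 9^a, and each further unit is one descent
    with \<open>\<sigma>\<close> = -1.\<close>
  have "\<exists>B. \<forall>t\<ge>1. \<bar>tricomi a (- t)\<bar> \<le> B * t powr (- 3 * a)" if "a + real n > 0" for n
    using that
  proof (induction n arbitrary: a)
    case 0
    then have a: "a > 0" by simp
    have "\<bar>tricomi a (- t)\<bar> \<le> 9 powr a * t powr (- 3 * a)" if t: "t \<ge> 1" for t
    proof -
      have "Gamma a * \<bar>tricomi a (- t)\<bar> = \<bar>laplace_tricomi a (a + 1/3) (t ^ 3 / 9)\<bar>"
        unfolding tricomi_eq_laplace[OF a less_le_trans[OF zero_less_one t], symmetric]
        using Gamma_real_pos[OF a] by (simp add: abs_mult)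
      also have "\<dots> \<le> Gamma a * (t ^ 3 / 9) powr (- a)"
        using laplace_tricomi_bounds[OF a, of "a + 1/3" "t ^ 3 / 9"] a t by simp
      finally have "\<bar>tricomi a (- t)\<bar> \<le> (t ^ 3 / 9) powr (- a)"
        using Gamma_real_pos[OF a] by simp
      also have "\<dots> = (t powr 3) powr (- a) / 9 powr (- a)"
        using t by (simp add: powr_divide)
      also have "\<dots> = 9 powr a * t powr (- 3 * a)"
        by (simp add: powr_powr powr_minus divide_inverse)
      finally show ?thesis .
    qed
    then show ?case by blast
  next
    case (Suc n)
    then obtain C where "\<forall>t\<ge>1. \<bar>tricomi (a + 1) (- t)\<bar> \<le> C * t powr (- 3 * (a + 1))"
      using Suc.IH[of "a + 1"] by auto
    then show ?case
      using tricomi_asymptotics_descent(2)[of a "-1" C] by simp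
  qed
  moreover obtain n :: nat where "- a < real n"
    using reals_Archimedean2 by blast
  then have "a + real n > 0" by simp
  ultimately show ?thesis by blast
qed

lemma tricomi_tendsto:
  assumes \<sigma>: "\<sigma> = 1 \<or> \<sigma> = (-1 :: real)"
  shows "\<exists>L. ((\<lambda>t. t powr (3 * a) * tricomi a (\<sigma> * t)) \<longlongrightarrow> L) at_top"
proof -
  obtain C where "\<forall>t\<ge>1. \<bar>tricomi (a + 1) (\<sigma> * t)\<bar> \<le> C * t powr (- 3 * (a + 1))"
    using \<sigma> tricomi_bound_at_top[of "a + 1"] tricomi_bound_at_bot[of "a + 1"] by auto
  then show ?thesis using tricomi_asymptotics_descent(1)[of a \<sigma> C] by blast
qed

text \<open>The Euler relation expresses t U'(a) through U(a) and U(a + 1). The latter decays faster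
  by t^(-3), so only the term with U(a) contributes to the limit.\<close>

lemma tricomi'_tendsto:
  assumes \<sigma>: "\<sigma> = 1 \<or> \<sigma> = (-1 :: real)"
  shows "\<exists>L. ((\<lambda>t. t powr (3 * a + 1) * tricomi' a (\<sigma> * t)) \<longlongrightarrow> L) at_top"
proof -
  obtain L where L: "((\<lambda>t. t powr (3 * a) * tricomi a (\<sigma> * t)) \<longlongrightarrow> L) at_top"
    using tricomi_tendsto[OF \<sigma>] by blast
  obtain L1 where L1: "((\<lambda>t. t powr (3 * (a + 1)) * tricomi (a + 1) (\<sigma> * t)) \<longlongrightarrow> L1) at_top"
    using tricomi_tendsto[OF \<sigma>] by blast
  have "((\<lambda>t::real. t powr (- 3)) \<longlongrightarrow> 0) at_top" by real_asymp
  then have "((\<lambda>t. \<sigma> * (- 3 * a * (t powr (3 * a) * tricomi a (\<sigma> * t))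
      + 3 * a * (a + 1/3) * (t powr (- 3) * (t powr (3 * (a + 1)) * tricomi (a + 1) (\<sigma> * t)))))
      \<longlongrightarrow> \<sigma> * (- 3 * a * L + 3 * a * (a + 1/3) * (0 * L1))) at_top"
    by (intro tendsto_intros L L1)
  then have "((\<lambda>t. t powr (3 * a + 1) * tricomi' a (\<sigma> * t))
      \<longlongrightarrow> \<sigma> * (- 3 * a * L + 3 * a * (a + 1/3) * (0 * L1))) at_top"
  proof (rule Lim_transform_eventually)
    show "\<forall>\<^sub>F t in at_top. \<sigma> * (- 3 * a * (t powr (3 * a) * tricomi a (\<sigma> * t))
      + 3 * a * (a + 1/3) * (t powr (- 3) * (t powr (3 * (a + 1)) * tricomi (a + 1) (\<sigma> * t))))
      = t powr (3 * a + 1) * tricomi' a (\<sigma> * t)"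
      using eventually_gt_at_top[of 0]
    proof eventually_elim
      case (elim t)
      have p: "t powr (- 3) * t powr (3 * (a + 1)) = t powr (3 * a)"
        by (simp add: powr_add[symmetric])
      have "\<sigma> * (- 3 * a * (t powr (3 * a) * tricomi a (\<sigma> * t))
          + 3 * a * (a + 1/3) * (t powr (- 3) * (t powr (3 * (a + 1)) * tricomi (a + 1) (\<sigma> * t))))
          = \<sigma> * t powr (3 * a) * (- 3 * a * tricomi a (\<sigma> * t) + 3 * a * (a + 1/3) * tricomi (a + 1) (\<sigma> * t))"
        unfolding mult.assoc[of "t powr (- 3)", symmetric] p by (simp only: algebra_simps)
      also have "\<dots> = \<sigma> * t powr (3 * a) * (\<sigma> * t * tricomi' a (\<sigma> * t))"
        by (simp only: tricomi_euler_operator)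
      also have "\<dots> = (\<sigma> * \<sigma>) * (t powr (3 * a) * t) * tricomi' a (\<sigma> * t)"
        by (simp only: mult_ac)
      also have "\<dots> = t powr (3 * a + 1) * tricomi' a (\<sigma> * t)"
        using \<sigma> elim by (auto simp: powr_add)
      finally show ?case .
    qed
  qed
  then show ?thesis by blast
qed

subsection \<open>Self-similar functions on the half-plane\<close>

text \<open>For x > 0 these are the functions homogeneous of degree 3\<open>\<kappa>\<close> under
  (x, z) -> (m^3 x, m z), m > 0, the scaling of the Kolmogorov equation. Hence an x-derivative
  lowers \<open>\<kappa>\<close> by 1 and a z-derivative lowers it by 1/3.\<close>

definition self_similar :: "real \<Rightarrow> (real \<Rightarrow> real) \<Rightarrow> real \<times> real \<Rightarrow> real" where
  "self_similar \<kappa> F p = fst p powr \<kappa> * F (snd p * fst p powr (- 1/3))"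

lemma has_real_derivative_self_similar_fst:
  assumes F: "\<And>t. (F has_real_derivative F' t) (at t)" and x: "x > 0"
  shows "((\<lambda>s. self_similar \<kappa> F (s, z)) has_real_derivative
    self_similar (\<kappa> - 1) (\<lambda>t. \<kappa> * F t - t * F' t / 3) (x, z)) (at x)"
proof -
  let ?t = "z * x powr (- 1/3)"
  have "((\<lambda>s. z * s powr (- 1/3)) has_real_derivative z * (- 1/3 * x powr (- 1/3 - 1))) (at x)"
    using x by (intro DERIV_cmult has_real_derivative_powr)
  from DERIV_mult[OF has_real_derivative_powr[OF x, of \<kappa>] DERIV_chain2[OF F this]]
  have "((\<lambda>s. self_similar \<kappa> F (s, z)) has_real_derivative
      \<kappa> * x powr (\<kappa> - 1) * F ?t + F' ?t * (z * (- 1/3 * x powr (- 1/3 - 1))) * x powr \<kappa>) (at x)"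
    by (simp add: self_similar_def)
  moreover have p: "x powr (e - 1) = x powr e / x" for e
    using x by (simp add: powr_diff)
  moreover have "\<kappa> * x powr (\<kappa> - 1) * F ?t + F' ?t * (z * (- 1/3 * x powr (- 1/3 - 1))) * x powr \<kappa>
      = self_similar (\<kappa> - 1) (\<lambda>t. \<kappa> * F t - t * F' t / 3) (x, z)"
    unfolding p using x by (simp add: self_similar_def p field_simps)
  ultimately show ?thesis by (simp only:)
qed

lemma has_real_derivative_self_similar_snd:
  assumes F: "\<And>t. (F has_real_derivative F' t) (at t)"
  shows "((\<lambda>s. self_similar \<kappa> F (x, s)) has_real_derivative self_similar (\<kappa> - 1/3) F' (x, z)) (at z)"
proof -
  have "((\<lambda>s. s * x powr (- 1/3)) has_real_derivative 1 * x powr (- 1/3)) (at z)"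
    by (intro DERIV_cmult_right DERIV_ident)
  from DERIV_cmult[OF DERIV_chain2[OF F this], of "x powr \<kappa>"]
  have "((\<lambda>s. self_similar \<kappa> F (x, s)) has_real_derivative
      (x powr \<kappa> * x powr (- 1/3)) * F' (z * x powr (- 1/3))) (at z)"
    by (simp add: self_similar_def mult_ac)
  also have "x powr \<kappa> * x powr (- 1/3) = x powr (\<kappa> - 1/3)"
    by (simp flip: powr_add)
  finally show ?thesis by (simp add: self_similar_def)
qed

text \<open>For \<open>x > 0\<close> and \<open>\<sigma> = sgn z\<close>, a self-similar function equals \<open>\<bar>z\<bar>\<^sup>3\<^sup>\<kappa> \<Psi> (x / \<bar>z\<bar>\<^sup>3)\<close>, where \<open>\<Psi>\<close> extends
  continuously to \<open>0\<close> exactly if \<open>t\<^sup>-\<^sup>3\<^sup>\<kappa> F (\<sigma> t)\<close> converges as \<open>t \<rightarrow> \<infinity>\<close>.\<close>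

lemma self_similar_profile_continuous:
  fixes F :: "real \<Rightarrow> real"
  assumes F: "continuous_on UNIV F"
    and L: "((\<lambda>t. t powr (- 3 * \<kappa>) * F (\<sigma> * t)) \<longlongrightarrow> L) at_top"
  shows "continuous_on UNIV (\<lambda>q. if q > 0 then q powr \<kappa> * F (\<sigma> * q powr (- 1/3)) else L)"
    (is "continuous_on UNIV ?\<Psi>")
proof -
  have pos: "continuous_on {0<..} ?\<Psi>"
  proof (subst continuous_on_cong[OF refl])
    show "continuous_on {0<..} (\<lambda>q. q powr \<kappa> * F (\<sigma> * q powr (- 1/3)))"
      by (intro continuous_intros continuous_on_compose2[OF F]) auto
  qed auto
  have neg: "continuous_on {..<0} ?\<Psi>"
    by (subst continuous_on_cong[OF refl, where g = "\<lambda>_. L"]) auto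
  have "isCont ?\<Psi> q" for q
  proof -
    consider "q > 0" | "q < 0" | "q = 0" by linarith
    then show ?thesis
    proof cases
      case 1
      with pos show ?thesis by (simp add: continuous_on_eq_continuous_at)
    next
      case 2
      with neg show ?thesis by (simp add: continuous_on_eq_continuous_at)
    next
      case 3
      \<comment> \<open>The substitution t = q^(-1/3) turns the limit at infinity into a one-sided
        limit at 0, with t^(-3 \<open>\<kappa>\<close>) = q^\<open>\<kappa>\<close>.\<close>
      have "filterlim (\<lambda>q::real. q powr (- 1/3)) at_top (at_right 0)" by real_asymp
      from filterlim_compose[OF L this]
      have "(?\<Psi> \<longlongrightarrow> L) (at_right 0)"
      proof (rule Lim_transform_eventually)
        show "\<forall>\<^sub>F q in at_right 0. (q powr (- 1/3)) powr (- 3 * \<kappa>) * F (\<sigma> * q powr (- 1/3)) = ?\<Psi> q"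
          using eventually_at_right_less[of 0] by eventually_elim (simp add: powr_powr)
      qed
      moreover have "(?\<Psi> \<longlongrightarrow> L) (at_left 0)"
        by (rule tendsto_eventually) (auto simp: eventually_at_filter)
      ultimately show ?thesis using 3 by (simp add: isCont_def filterlim_at_split)
    qed
  qed
  then show ?thesis by (intro continuous_at_imp_continuous_on) auto
qed

text \<open>The open half-planes x > 0, z > 0 and z < 0 cover \<open>Pstar\<close>. On the first the
  defining formula is continuous; on the other two the continuous profile in q = x/|z|^3 takes
  over.\<close>

lemma self_similar_extends:
  assumes F: "continuous_on UNIV F"
    and lim: "\<And>\<sigma>. \<sigma> = 1 \<or> \<sigma> = -1 \<Longrightarrow> \<exists>L. ((\<lambda>t. t powr (- 3 * \<kappa>) * F (\<sigma> * t)) \<longlongrightarrow> L) at_top"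
  shows "\<exists>g. continuous_on Pstar g \<and> (\<forall>p\<in>Hplus. g p = self_similar \<kappa> F p)"
proof -
  obtain Lp where Lp: "((\<lambda>t. t powr (- 3 * \<kappa>) * F (1 * t)) \<longlongrightarrow> Lp) at_top" using lim by blast
  obtain Ln where Ln: "((\<lambda>t. t powr (- 3 * \<kappa>) * F (- 1 * t)) \<longlongrightarrow> Ln) at_top" using lim by blast
  define \<Psi>p where "\<Psi>p = (\<lambda>q. if q > 0 then q powr \<kappa> * F (1 * q powr (- 1/3)) else Lp)"
  define \<Psi>n where "\<Psi>n = (\<lambda>q. if q > 0 then q powr \<kappa> * F (- 1 * q powr (- 1/3)) else Ln)"
  \<comment> \<open>For x <= 0 the boundary value is continued constantly in x. This makes
    \<open>g\<close> continuous on the full open sets \<open>Zpos\<close> and \<open>Zneg\<close>,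
    so that continuity can be glued on open sets.\<close>
  define g where "g = (\<lambda>p::real \<times> real. if fst p > 0 then self_similar \<kappa> F p
    else if snd p > 0 then snd p powr (3 * \<kappa>) * Lp else (- snd p) powr (3 * \<kappa>) * Ln)"
  define Zpos where "Zpos = {p::real \<times> real. snd p > 0}"
  define Zneg where "Zneg = {p::real \<times> real. snd p < 0}"
  have "open Hplus" "open Zpos" "open Zneg"
    unfolding Hplus_def Zpos_def Zneg_def by (intro open_Collect_less continuous_intros)+
  have scale: "z powr (3 * \<kappa>) * ((x / z ^ 3) powr \<kappa>) = x powr \<kappa>" "(x / z ^ 3) powr (- 1/3) = z * x powr (- 1/3)"
    if "x > 0" "z > 0" for x z :: real
  proof -
    have "(z ^ 3) powr e = z powr (3 * e)" for e
      using that powr_realpow[of z 3] by (metis of_nat_numeral powr_powr)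
    then show "z powr (3 * \<kappa>) * ((x / z ^ 3) powr \<kappa>) = x powr \<kappa>" "(x / z ^ 3) powr (- 1/3) = z * x powr (- 1/3)"
      using that by (simp_all add: powr_divide powr_minus field_simps)
  qed
  have "continuous_on Hplus g"
  proof (subst continuous_on_cong[OF refl])
    show "continuous_on Hplus (self_similar \<kappa> F)"
      unfolding self_similar_def
      by (intro continuous_intros continuous_on_compose2[OF F]) (auto simp: Hplus_def)
  qed (auto simp: g_def Hplus_def)
  moreover have "continuous_on Zpos g"
  proof (subst continuous_on_cong[OF refl])
    show "continuous_on Zpos (\<lambda>p. snd p powr (3 * \<kappa>) * \<Psi>p (fst p / snd p ^ 3))"
      unfolding \<Psi>p_def
      by (intro continuous_intros continuous_on_compose2[OF self_similar_profile_continuous[OF F Lp]])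
         (auto simp: Zpos_def)
    show "g p = snd p powr (3 * \<kappa>) * \<Psi>p (fst p / snd p ^ 3)" if "p \<in> Zpos" for p
      using that scale[of "fst p" "snd p"]
      by (auto simp: g_def Zpos_def \<Psi>p_def self_similar_def zero_less_divide_iff)
  qed
  moreover have "continuous_on Zneg g"
  proof (subst continuous_on_cong[OF refl])
    show "continuous_on Zneg (\<lambda>p. (- snd p) powr (3 * \<kappa>) * \<Psi>n (fst p / (- snd p) ^ 3))"
      unfolding \<Psi>n_def
      by (intro continuous_intros continuous_on_compose2[OF self_similar_profile_continuous[OF F Ln]])
         (auto simp: Zneg_def)
    show "g p = (- snd p) powr (3 * \<kappa>) * \<Psi>n (fst p / (- snd p) ^ 3)" if "p \<in> Zneg" for p
    proof (cases "fst p > 0")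
      case True
      then have "fst p / (- snd p) ^ 3 > 0" using that by (intro divide_pos_pos zero_less_power) (auto simp: Zneg_def)
      then show ?thesis
        using True that scale[of "fst p" "- snd p"]
        by (auto simp: g_def Zneg_def \<Psi>n_def self_similar_def simp del: power_minus_odd)
    next
      case False
      have "(- snd p) ^ 3 > 0" using that by (intro zero_less_power) (auto simp: Zneg_def)
      then have "\<not> fst p / (- snd p) ^ 3 > 0" using False by (simp add: zero_less_divide_iff del: power_minus_odd)
      then show ?thesis
        using False that by (auto simp: g_def Zneg_def \<Psi>n_def simp del: power_minus_odd)
    qed
  qed
  ultimately have "continuous_on (Hplus \<union> (Zpos \<union> Zneg)) g"
    using \<open>open Hplus\<close> \<open>open Zpos\<close> \<open>open Zneg\<close> by (intro continuous_on_open_Un open_Un)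
  moreover have "Pstar \<subseteq> Hplus \<union> (Zpos \<union> Zneg)"
    by (auto simp: Pstar_def Hplus_def Zpos_def Zneg_def)
  ultimately have "continuous_on Pstar g" by (rule continuous_on_subset)
  moreover have "\<forall>p\<in>Hplus. g p = self_similar \<kappa> F p" by (auto simp: g_def Hplus_def)
  ultimately show ?thesis by blast
qed

section \<open>Closure of the Tricomi family under partial derivatives\<close>

lemma tricomi_second_derivative:
  "(tricomi' a has_real_derivative - a * (a + 1/3) * (t * tricomi (a + 1) t)) (at t)"
proof -
  \<comment> \<open>Factoring out -t/3 exposes the Euler operator, which leaves U(a + 1) only. This
    is the Kolmogorov equation in the similarity variable.\<close>
  have "- (t\<^sup>2) / 3 * tricomi' a t - a * t * tricomi a t = - t / 3 * (t * tricomi' a t + 3 * a * tricomi a t)"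
    by (simp add: power2_eq_square algebra_simps)
  also have "\<dots> = - a * (a + 1/3) * (t * tricomi (a + 1) t)"
    unfolding tricomi_euler_operator by (simp add: algebra_simps)
  finally show ?thesis using has_real_derivative_tricomi'[of a t] by simp
qed

text \<open>Obtained by differentiating both sides of \<open>tricomi_euler_operator\<close> and
  using uniqueness of the derivative.\<close>

lemma tricomi'_euler_operator:
  "t * (- a * (a + 1/3) * (t * tricomi (a + 1) t))
    = - (3 * a + 1) * tricomi' a t + 3 * a * (a + 1/3) * tricomi' (a + 1) t"
proof -
  have "((\<lambda>t. t * tricomi' a t) has_real_derivative
      t * (- a * (a + 1/3) * (t * tricomi (a + 1) t)) + 1 * tricomi' a t) (at t)"
    by (intro DERIV_mult' DERIV_ident tricomi_second_derivative)
  moreover have "((\<lambda>t. - 3 * a * tricomi a t + 3 * a * (a + 1/3) * tricomi (a + 1) t) has_real_derivative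
      - 3 * a * tricomi' a t + 3 * a * (a + 1/3) * tricomi' (a + 1) t) (at t)"
    by (intro DERIV_add DERIV_cmult has_real_derivative_tricomi)
  ultimately have "t * (- a * (a + 1/3) * (t * tricomi (a + 1) t)) + 1 * tricomi' a t
      = - 3 * a * tricomi' a t + 3 * a * (a + 1/3) * tricomi' (a + 1) t"
    unfolding tricomi_euler_operator by (rule DERIV_unique)
  then show ?thesis by (simp add: algebra_simps)
qed

text \<open>The generators are the self-similar solutions and their z-derivatives. Closure under
  multiplication by z is there because a second z-derivative produces z times an
  x-derivative.\<close>

inductive_set kolmogorov_span :: "(real \<times> real \<Rightarrow> real) set" where
  base: "self_similar \<kappa> (tricomi (- \<kappa>)) \<in> kolmogorov_span"
| base': "self_similar (\<kappa> - 1/3) (tricomi' (- \<kappa>)) \<in> kolmogorov_span"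
| add: "f \<in> kolmogorov_span \<Longrightarrow> g \<in> kolmogorov_span \<Longrightarrow> (\<lambda>p. f p + g p) \<in> kolmogorov_span"
| scale: "f \<in> kolmogorov_span \<Longrightarrow> (\<lambda>p. c * f p) \<in> kolmogorov_span"
| mult_snd: "f \<in> kolmogorov_span \<Longrightarrow> (\<lambda>p. snd p * f p) \<in> kolmogorov_span"

lemma kolmogorov_span_extends:
  assumes "f \<in> kolmogorov_span"
  shows "\<exists>g. continuous_on Pstar g \<and> (\<forall>p\<in>Hplus. g p = f p)"
  using assms
proof induction
  case (base \<kappa>)
  show ?case
    using tricomi_tendsto[of _ "- \<kappa>"]
    by (intro self_similar_extends continuous_on_tricomi continuous_on_id) auto
next
  case (base' \<kappa>)
  have "- 3 * (\<kappa> - 1/3) = 3 * (- \<kappa>) + 1" by simp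
  moreover have "continuous_on UNIV (tricomi' (- \<kappa>))"
    by (auto intro!: DERIV_continuous_on has_field_derivative_at_within[OF has_real_derivative_tricomi'])
  ultimately show ?case
    using tricomi'_tendsto[of _ "- \<kappa>"] by (intro self_similar_extends) auto
next
  case (add f g)
  then obtain f' g' where "continuous_on Pstar f'" "\<forall>p\<in>Hplus. f' p = f p"
      "continuous_on Pstar g'" "\<forall>p\<in>Hplus. g' p = g p" by blast
  then show ?case
    by (intro exI[of _ "\<lambda>p. f' p + g' p"]) (auto intro!: continuous_intros)
next
  case (scale f c)
  then obtain f' where "continuous_on Pstar f'" "\<forall>p\<in>Hplus. f' p = f p" by blast
  then show ?case
    by (intro exI[of _ "\<lambda>p. c * f' p"]) (auto intro!: continuous_intros)
next
  case (mult_snd f)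
  then obtain f' where "continuous_on Pstar f'" "\<forall>p\<in>Hplus. f' p = f p" by blast
  then show ?case
    by (intro exI[of _ "\<lambda>p. snd p * f' p"]) (auto intro!: continuous_intros)
qed

text \<open>An x-derivative takes each generator to a multiple of the same kind with
  \<open>\<kappa>\<close> - 1. A z-derivative takes the first kind to the second, and the second to
  a multiple of z times the first kind with \<open>\<kappa>\<close> - 1.\<close>

lemma kolmogorov_span_partials:
  assumes "f \<in> kolmogorov_span"
  shows "\<exists>fx\<in>kolmogorov_span. \<exists>fz\<in>kolmogorov_span. \<forall>x z. x > 0 \<longrightarrow>
    ((\<lambda>s. f (s, z)) has_real_derivative fx (x, z)) (at x) \<and>
    ((\<lambda>s. f (x, s)) has_real_derivative fz (x, z)) (at z)"
  using assms
proof induction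
  case (base \<kappa>)
  \<comment> \<open>This is -a(a + 1/3) at a = -\<open>\<kappa>\<close>.\<close>
  define c where "c = \<kappa> * (1/3 - \<kappa>)"
  have "\<kappa> * tricomi (- \<kappa>) t - t * tricomi' (- \<kappa>) t / 3 = c * tricomi (- (\<kappa> - 1)) t" for t
    unfolding tricomi_euler_operator by (simp add: c_def algebra_simps add_divide_distrib diff_divide_distrib)
  then have "self_similar (\<kappa> - 1) (\<lambda>t. \<kappa> * tricomi (- \<kappa>) t - t * tricomi' (- \<kappa>) t / 3)
      = (\<lambda>p. c * self_similar (\<kappa> - 1) (tricomi (- (\<kappa> - 1))) p)"
    by (simp add: self_similar_def fun_eq_iff)
  then have dx: "((\<lambda>s. self_similar \<kappa> (tricomi (- \<kappa>)) (s, z)) has_real_derivative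
      c * self_similar (\<kappa> - 1) (tricomi (- (\<kappa> - 1))) (x, z)) (at x)" if "x > 0" for x z
    using has_real_derivative_self_similar_fst[OF has_real_derivative_tricomi that, of \<kappa> "- \<kappa>" z] by simp
  show ?case
    by (rule bexI[OF _ kolmogorov_span.scale[OF kolmogorov_span.base]], rule bexI[OF _ kolmogorov_span.base'],
        intro allI impI conjI, erule dx,
        rule has_real_derivative_self_similar_snd[OF has_real_derivative_tricomi])
next
  case (base' \<kappa>)
  define c where "c = \<kappa> * (1/3 - \<kappa>)"
  define T'' where "T'' = (\<lambda>t. c * (t * tricomi (- (\<kappa> - 1)) t))"
  have T'': "(tricomi' (- \<kappa>) has_real_derivative T'' t) (at t)" for t
    using tricomi_second_derivative[of "- \<kappa>" t] by (simp add: T''_def c_def algebra_simps)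
  have "(\<kappa> - 1/3) * tricomi' (- \<kappa>) t - t * T'' t / 3 = c * tricomi' (- (\<kappa> - 1)) t" for t
    using tricomi'_euler_operator[of t "- \<kappa>"]
    by (simp add: T''_def c_def algebra_simps add_divide_distrib diff_divide_distrib)
  then have "self_similar (\<kappa> - 1/3 - 1) (\<lambda>t. (\<kappa> - 1/3) * tricomi' (- \<kappa>) t - t * T'' t / 3)
      = (\<lambda>p. c * self_similar (\<kappa> - 1 - 1/3) (tricomi' (- (\<kappa> - 1))) p)"
    by (simp add: self_similar_def fun_eq_iff)
  then have dx: "((\<lambda>s. self_similar (\<kappa> - 1/3) (tricomi' (- \<kappa>)) (s, z)) has_real_derivative
      c * self_similar (\<kappa> - 1 - 1/3) (tricomi' (- (\<kappa> - 1))) (x, z)) (at x)" if "x > 0" for x z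
    using has_real_derivative_self_similar_fst[OF T'' that, of "\<kappa> - 1/3" z] by simp
  have dz: "((\<lambda>s. self_similar (\<kappa> - 1/3) (tricomi' (- \<kappa>)) (x, s)) has_real_derivative
      c * (snd (x, z) * self_similar (\<kappa> - 1) (tricomi (- (\<kappa> - 1))) (x, z))) (at z)" for x z
  proof -
    \<comment> \<open>The factor t in \<open>T''\<close> equals z x^(-1/3); its power of x completes
      the exponent to \<open>\<kappa>\<close> - 1, and z remains as a coefficient.\<close>
    have "x powr (\<kappa> - 1/3 - 1/3) * x powr (- 1/3) = x powr (\<kappa> - 1)"
      by (simp flip: powr_add)
    then have "self_similar (\<kappa> - 1/3 - 1/3) T'' (x, z)
        = c * (snd (x, z) * self_similar (\<kappa> - 1) (tricomi (- (\<kappa> - 1))) (x, z))"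
      by (simp add: self_similar_def T''_def)
    then show ?thesis
      using has_real_derivative_self_similar_snd[OF T'', of "\<kappa> - 1/3" x z] by simp
  qed
  show ?case
    by (rule bexI[OF _ kolmogorov_span.scale[OF kolmogorov_span.base']],
        rule bexI[OF _ kolmogorov_span.scale[OF kolmogorov_span.mult_snd[OF kolmogorov_span.base]]],
        intro allI impI conjI, erule dx, rule dz)
next
  case (add f g)
  obtain fx fz where f: "fx \<in> kolmogorov_span" "fz \<in> kolmogorov_span"
    and "\<And>x z. x > 0 \<Longrightarrow> ((\<lambda>s. f (s, z)) has_real_derivative fx (x, z)) (at x)"
        "\<And>x z. x > 0 \<Longrightarrow> ((\<lambda>s. f (x, s)) has_real_derivative fz (x, z)) (at z)"
    using add.IH(1) by meson
  moreover obtain gx gz where g: "gx \<in> kolmogorov_span" "gz \<in> kolmogorov_span"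
    and "\<And>x z. x > 0 \<Longrightarrow> ((\<lambda>s. g (s, z)) has_real_derivative gx (x, z)) (at x)"
        "\<And>x z. x > 0 \<Longrightarrow> ((\<lambda>s. g (x, s)) has_real_derivative gz (x, z)) (at z)"
    using add.IH(2) by meson
  ultimately show ?case
    by (rule_tac bexI[OF _ kolmogorov_span.add[OF f(1) g(1)]], rule_tac bexI[OF _ kolmogorov_span.add[OF f(2) g(2)]])
       (auto intro!: DERIV_add)
next
  case (scale f c)
  obtain fx fz where *: "fx \<in> kolmogorov_span" "fz \<in> kolmogorov_span"
    and "\<And>x z. x > 0 \<Longrightarrow> ((\<lambda>s. f (s, z)) has_real_derivative fx (x, z)) (at x)"
        "\<And>x z. x > 0 \<Longrightarrow> ((\<lambda>s. f (x, s)) has_real_derivative fz (x, z)) (at z)"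
    using scale.IH by meson
  then show ?case
    by (rule_tac bexI[OF _ kolmogorov_span.scale[OF *(1)]], rule_tac bexI[OF _ kolmogorov_span.scale[OF *(2)]])
       (auto intro!: DERIV_cmult)
next
  case (mult_snd f)
  obtain fx fz where *: "fx \<in> kolmogorov_span" "fz \<in> kolmogorov_span"
    and fx: "\<And>x z. x > 0 \<Longrightarrow> ((\<lambda>s. f (s, z)) has_real_derivative fx (x, z)) (at x)"
    and fz: "\<And>x z. x > 0 \<Longrightarrow> ((\<lambda>s. f (x, s)) has_real_derivative fz (x, z)) (at z)"
    using mult_snd.IH by meson
  have dx: "((\<lambda>s. snd (s, z) * f (s, z)) has_real_derivative snd (x, z) * fx (x, z)) (at x)" if "x > 0" for x z
    using DERIV_cmult[OF fx[OF that], of z z] by simp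
  have dz: "((\<lambda>s. snd (x, s) * f (x, s)) has_real_derivative snd (x, z) * fz (x, z) + f (x, z)) (at z)"
    if "x > 0" for x z
    using DERIV_mult'[OF DERIV_ident fz[OF that, of z]] by simp
  show ?case
    by (rule bexI[OF _ kolmogorov_span.mult_snd[OF *(1)]],
        rule bexI[OF _ kolmogorov_span.add[OF kolmogorov_span.mult_snd[OF *(2)] \<open>f \<in> kolmogorov_span\<close>]],
        intro allI impI conjI, erule dx, erule dz)
qed

section \<open>The functions v_k and their iterated derivatives\<close>

lemma v_eq_self_similar:
  assumes "p \<in> Hplus"
  shows "v k p = 9 powr (1/6 + real_of_int k)
    * self_similar (1/6 + real_of_int k) (tricomi (- (1/6 + real_of_int k))) p"
proof -
  obtain x z where p: "p = (x, z)" by (cases p)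
  have x: "x > 0" using assms by (simp add: p Hplus_def)
  define e where "e = 1/2 + 3 * real_of_int k"
  define \<kappa> where "\<kappa> = 1/6 + real_of_int k"
  define t where "t = z * x powr (- 1/3)"
  \<comment> \<open>Since r^2 = x^(2/3) (1 + t^2), the factor r^e is x^\<open>\<kappa>\<close> times
    a power of 1 + t^2, and that power cancels the weight in \<open>Lambda\<close>.\<close>
  have "x powr (2/3) * (x powr (- 1/3))\<^sup>2 = 1"
    using x by (simp add: power2_eq_square flip: powr_add)
  then have "z\<^sup>2 + x powr (2/3) = x powr (2/3) * (1 + t\<^sup>2)"
    by (simp add: t_def power_mult_distrib algebra_simps)
  then have "sqrt (z\<^sup>2 + x powr (2/3)) powr e = (x powr (2/3) * (1 + t\<^sup>2)) powr (1/2 * e)"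
    by (simp add: powr_powr flip: powr_half_sqrt)
  also have "\<dots> = x powr \<kappa> * (1 + t\<^sup>2) powr (e / 2)"
    by (simp add: powr_mult powr_powr e_def \<kappa>_def add_divide_distrib)
  finally have r: "sqrt (z\<^sup>2 + x powr (2/3)) powr e = x powr \<kappa> * (1 + t\<^sup>2) powr (e / 2)" .
  have "1 + t\<^sup>2 > 0" by (simp add: add_pos_nonneg)
  moreover have "e / 2 + (-1/4 - 3 * real_of_int k / 2) = 0" by (simp add: e_def field_simps)
  ultimately have cancel: "(1 + t\<^sup>2) powr (e / 2) * (1 + t\<^sup>2) powr (-1/4 - 3 * real_of_int k / 2) = 1"
    by (simp only: powr_add[symmetric] powr_zero_eq_one) simp
  have e: "-1/6 - real_of_int k = - \<kappa>" "1/6 - real_of_int k = - \<kappa> + 1/3" by (simp_all add: \<kappa>_def)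
  have "Lambda k t = 9 powr \<kappa> * (1 + t\<^sup>2) powr (-1/4 - 3 * real_of_int k / 2) * tricomi (- \<kappa>) t"
    unfolding Lambda_def tricomi_def e \<kappa>_def[symmetric]
    by (simp only: rGamma_inverse_Gamma divide_inverse)
  moreover have "v k p = sqrt (z\<^sup>2 + x powr (2/3)) powr e * Lambda k t"
    by (simp add: v_def p t_def e_def)
  ultimately have "v k p = ((1 + t\<^sup>2) powr (e / 2) * (1 + t\<^sup>2) powr (-1/4 - 3 * real_of_int k / 2))
      * (9 powr \<kappa> * (x powr \<kappa> * tricomi (- \<kappa>) t))"
    unfolding r by (simp only: mult_ac)
  then show ?thesis
    unfolding cancel by (simp add: self_similar_def p t_def \<kappa>_def)
qed

lemma eventually_Hplus_line:
  assumes "p \<in> Hplus"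
  shows "\<forall>\<^sub>F s in nhds (fst p). (s, snd p) \<in> Hplus" "\<forall>\<^sub>F s in nhds (snd p). (fst p, s) \<in> Hplus"
  using assms eventually_nhds_in_open[of "{0<..}" "fst p"] by (auto simp: Hplus_def)

text \<open>Induction on the word, whose head is the outermost derivative. Agreement on
  \<open>Hplus\<close> suffices for equal derivatives, because \<open>Hplus\<close> is open along
  both coordinate lines.\<close>

lemma pdw_v_in_kolmogorov_span:
  "\<exists>f\<in>kolmogorov_span. \<forall>p\<in>Hplus. pdw ws (v k) p = f p"
proof (induction ws)
  case Nil
  show ?case
    using v_eq_self_similar[of _ k]
      kolmogorov_span.scale[OF kolmogorov_span.base, of "9 powr (1/6 + real_of_int k)" "1/6 + real_of_int k"]
    by (auto simp: pdw_def)
next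
  case (Cons b ws)
  then obtain f where f: "f \<in> kolmogorov_span" "\<And>p. p \<in> Hplus \<Longrightarrow> pdw ws (v k) p = f p" by blast
  obtain fx fz where *: "fx \<in> kolmogorov_span" "fz \<in> kolmogorov_span"
    and fx: "\<And>x z. x > 0 \<Longrightarrow> ((\<lambda>s. f (s, z)) has_real_derivative fx (x, z)) (at x)"
    and fz: "\<And>x z. x > 0 \<Longrightarrow> ((\<lambda>s. f (x, s)) has_real_derivative fz (x, z)) (at z)"
    using kolmogorov_span_partials[OF f(1)] by meson
  have "pdw (b # ws) (v k) p = (if b then fx else fz) p" if p: "p \<in> Hplus" for p
  proof -
    have "deriv (\<lambda>s. pdw ws (v k) (s, snd p)) (fst p) = deriv (\<lambda>s. f (s, snd p)) (fst p)"
      using eventually_Hplus_line(1)[OF p] by (intro deriv_cong_ev) (auto elim!: eventually_mono simp: f(2))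
    moreover have "deriv (\<lambda>s. pdw ws (v k) (fst p, s)) (snd p) = deriv (\<lambda>s. f (fst p, s)) (snd p)"
      using eventually_Hplus_line(2)[OF p] by (intro deriv_cong_ev) (auto elim!: eventually_mono simp: f(2))
    moreover have "fst p > 0" using p by (simp add: Hplus_def)
    ultimately show ?thesis
      using DERIV_imp_deriv[OF fx, of "fst p" "snd p"] DERIV_imp_deriv[OF fz, of "fst p" "snd p"]
      by (simp add: pdw_def partial_def)
  qed
  then show ?case using * by (intro bexI[of _ "if b then fx else fz"]) auto
qed

theorem lemma2p16:
  fixes k :: int
  shows "smooth_ext_Pstar (v k)"
  unfolding smooth_ext_Pstar_def
proof (intro allI conjI ballI)
  fix ws
  obtain f where f: "f \<in> kolmogorov_span" "\<And>p. p \<in> Hplus \<Longrightarrow> pdw ws (v k) p = f p"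
    using pdw_v_in_kolmogorov_span by blast
  show "\<exists>g. continuous_on Pstar g \<and> (\<forall>p\<in>Hplus. g p = pdw ws (v k) p)"
    using kolmogorov_span_extends[OF f(1)] f(2) by auto
  fix p assume p: "p \<in> Hplus"
  then have "fst p > 0" by (simp add: Hplus_def)
  then obtain d d' where "((\<lambda>s. f (s, snd p)) has_real_derivative d) (at (fst p))"
      "((\<lambda>s. f (fst p, s)) has_real_derivative d') (at (snd p))"
    using kolmogorov_span_partials[OF f(1)] by blast
  \<comment> \<open>Differentiability is proved separately, since \<open>deriv\<close> has a value
    even where no derivative exists; it is transferred from \<open>f\<close> by agreement near the
    point.\<close>
  moreover have "\<forall>\<^sub>F s in nhds (fst p). f (s, snd p) = pdw ws (v k) (s, snd p)"
    using eventually_Hplus_line(1)[OF p] by eventually_elim (simp add: f(2))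
  note DERIV_cong_ev[OF refl this refl]
  moreover have "\<forall>\<^sub>F s in nhds (snd p). f (fst p, s) = pdw ws (v k) (fst p, s)"
    using eventually_Hplus_line(2)[OF p] by eventually_elim (simp add: f(2))
  note DERIV_cong_ev[OF refl this refl]
  ultimately have "((\<lambda>s. pdw ws (v k) (s, snd p)) has_real_derivative d) (at (fst p))"
      "((\<lambda>s. pdw ws (v k) (fst p, s)) has_real_derivative d') (at (snd p))"
    by blast+
  then show "(\<lambda>s. pdw ws (v k) (s, snd p)) differentiable (at (fst p))"
      "(\<lambda>s. pdw ws (v k) (fst p, s)) differentiable (at (snd p))"
    by (auto simp: real_differentiable_def)
qed

end
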